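(* Let $\varphi:\mathbb T^d\to\mathbb T^d$ be the piecewise affine linear Bernoulli map, and $(X_n)$ the Markov process $X_{n+1}=\varphi(X_n)+\epsilon\zeta_{n+1}$, described in the context. Suppose that either the Gaussian Assumption or the Separated Assumption (both stated in the context) holds. Then there exists a constant $C$ (independent of $\epsilon$) such that for all sufficiently small $\epsilon>0$, $$t_{\mathrm{mix}}\le C\,|\ln\epsilon| .$$
   Context: **Process.** $\mathbb T^d=\mathbb R^d/\mathbb Z^d$, $\Pi:\mathbb R^d\to\mathbb T^d$ is the canonical projection, and $\pi$ is Lebesgue (probability) measure on $\mathbb T^d$. For $x\in\mathbb T^d$, $\check x\in[0,1)^d$ is the unique point with $\Pi(\check x)=x$. For each $\epsilon>0$, $(\epsilon\zeta_n)_{n\ge1}$ are i.i.d. $\mathbb T^d$-valued random variables, independent of $X_0$, whose law has density $K_\epsilon$ with respect to $\pi$, and $X_{n+1}=\varphi(X_n)+\epsilon\zeta_{n+1}$. **Mixing time.** $t_{\mathrm{mix}}(\delta)=\min\{n\in\mathbb N:\ \|\mathrm{dist}(X_n)-\pi\|_{TV}\le\delta\text{ for all initial distributions of }X_0\}$ and $t_{\mathrm{mix}}=t_{\mathrm{mix}}(1/2)$. Total variation is normalized so that $\|\mu-\pi\|_{TV}=\frac12\|f-1\|_{L^1(\pi)}$ if $\mu=f\,\pi$, i.e. $\|\mu-\nu\|_{TV}=\sup_A|\mu(A)-\nu(A)|$. **The map $\varphi$.** Let $M\ge2$, $\mathcal I=\{1,\dots,M\}$, and let $\check E_1,\dots,\check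 E_M$ be a partition of $[0,1)^d$; if $d=1$ each $\check E_i$ is an interval, if $d>1$ each $\check E_i$ is a $d$-dimensional cube with sides parallel to the coordinate axes. Let $p_i\in(0,1)$ be the Lebesgue measure of $\check E_i$. Assume $\check\varphi_i:\check E_i\to[0,1)^d$ are affine bijections $\check\varphi_i(\check x)=p_i^{-1/d}\check D_i\check x+\check e_i$ with $\check e_i\in\mathbb R^d$ and $\check D_i$ orthogonal matrices. Let $E_i=\Pi(\check E_i)$, $\varphi_i(x)=\Pi(\check\varphi_i(\check x))$ for $x\in E_i$, and $\varphi(x)=\varphi_i(x)$ if $x\in E_i$. **Cylinder sets.** $\mathcal T$ is the set of all finite tuples with entries in $\mathcal I$, including the empty tuple $\mathbf 0$. For $s=(s_0,\dots,s_{m-1})\in\mathcal T$, $|s|=m$ and $\mathcal C_s=\{x\in\mathbb T^d:\varphi^n(x)\in E_{s_n}\text{ for all }0\le n<|s|\}$; $\mathcal C_{\mathbf 0}=\mathbb T^d$. **Cubes Assumption.** (1) Each $\varphi_i:E_i\to\mathbb T^d$ is a bijection. (2) For every $\check x\in\partial[0,1]^d$ there exist $i\in\mathcal I$ and $\check y\in(0,1)^d$ such that $\check\varphi_i(\check y)=\check x$, where $\check\varphi_i$ here denotes the affine map on $\mathbb R^d$ given by the same formula. (3) If $d\ge2$, every cylinder set $\mathcal C_s$ is an axis-aligned cube. **Rescaling and periodizing.** $K_\epsilon$ is obtained from a probability density $\check K$ on $\mathbb R^d$ by rescaling and periodizing if $K_\epsilon(x)=\sum_{n\in\mathbb Z^d}\check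 K_\epsilon(\check x+n)$ with $\check K_\epsilon(\check x)=\epsilon^{-d}\check K(\check x/\epsilon)$. **Gaussian Assumption.** The Cubes Assumption holds; $K_\epsilon$ is obtained by rescaling and periodizing $\check K$, where $\check K$ is the density of a Gaussian in $\mathbb R^d$ with mean $0$ and non-degenerate covariance matrix; and $\check K(\check D_i\check x)=\check K(\check x)$ for all $\check x\in\mathbb R^d$, $i\in\mathcal I$. **Separated Assumption.** The Cubes Assumption holds, $K_\epsilon$ is obtained by rescaling and periodizing $\check K$, and: (a) for every $\eta>0$, $\inf_{\check x,\check y\in[0,\eta)^d}\check K(\check x-\check y)>0$; (b) there are probability densities $\check K_n$, $n\ge1$, with $\check K_n\to\check K$ in $L^1(\mathbb R^d)$, each of the form $\check K_n(\check x)=\sum_{i=1}^n b_{n,i}\prod_{j=1}^d\check k_{n,i}(\check x_j)$ with even nonnegative functions $\check k_{n,i}:\mathbb R\to\mathbb R$ and constants $b_{n,i}\ge0$, and there is a constant $A>0$ such that for all $n,i$: $\int_{\mathbb R}\check k_{n,i}(t)\,dt=1$, $\int_{\mathbb R}|t|\check k_{n,i}(t)\,dt\le A$, $\int_0^{1/2}t\,\check k_{n,i}(t)\,dt\ge 1/A$; (c) $\check K(\check D_i\check x)=\check K(\check x)$ for all $\check x\in\mathbb R^d$, $i\in\mathcal I$. *)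

theory Defs
  imports "HOL-Probability.Probability"
begin

section \<open>The torus\<close>

definition int_translate :: "real^'d \<Rightarrow> real^'d \<Rightarrow> bool" where
  "int_translate x y \<longleftrightarrow> (\<forall>j. x $ j - y $ j \<in> \<int>)"

lemma equivp_int_translate: "equivp int_translate"
proof (rule equivpI)
  show "reflp int_translate" by (simp add: reflp_def int_translate_def)
  show "symp int_translate"
    unfolding symp_def int_translate_def by (metis Ints_minus minus_diff_eq)
  show "transp int_translate"
    unfolding transp_def int_translate_def by (metis Ints_add diff_add_cancel add_diff_eq)
qed

quotient_type (overloaded) 'd torus = "real^('d::finite)" / int_translate
  by (rule equivp_int_translate)

lift_definition proj :: "real^'d \<Rightarrow> 'd::finite torus" is "\<lambda>x. x" .

instantiation torus :: (finite) plus
begin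

lift_definition plus_torus :: "'a torus \<Rightarrow> 'a torus \<Rightarrow> 'a torus" is "\<lambda>x y. x + y"
  unfolding int_translate_def by (metis Ints_add add_diff_add vector_add_component)

instance ..

end

text \<open>The torus carries the quotient topology, so that \<open>borel :: 'd torus measure\<close> is its Borel
  \<open>\<sigma>\<close>-algebra.\<close>

instantiation torus :: (finite) topological_space
begin

definition open_torus :: "'a torus set \<Rightarrow> bool" where
  "open_torus U \<longleftrightarrow> open (proj -` U)"

instance
proof
  show "open (UNIV :: 'a torus set)" by (simp add: open_torus_def)
  show "open (S \<inter> T)" if "open S" "open T" for S T :: "'a torus set"
    using that by (simp add: open_torus_def open_Int)
  show "open (\<Union> K)" if "\<forall>S\<in>K. open S" for K :: "'a torus set set"
    using that by (auto simp: open_torus_def vimage_Union)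
qed

end

definition unit_cube :: "(real^'d) set" where
  "unit_cube = {x. \<forall>j. 0 \<le> x $ j \<and> x $ j < 1}"

definition check :: "'d::finite torus \<Rightarrow> real^'d" where
  "check x = (THE y. y \<in> unit_cube \<and> proj y = x)"

definition torus_measure :: "'d::finite torus measure" where
  "torus_measure = distr (restrict_space lborel unit_cube) borel proj"

section \<open>The process and its mixing time\<close>

text \<open>The process is realised on the canonical space: \<open>\<omega> = (x, z)\<close> consists of the starting point
  \<open>x\<close>, distributed according to \<open>\<mu>\<close>, and the noise sequence \<open>(z\<^sub>n)\<close>, \<open>n \<ge> 1\<close>, independent of \<open>x\<close> and
  i.i.d. with law \<open>Q\<close>.\<close>

definition path_space ::
    "'d::finite torus measure \<Rightarrow> 'd torus measure \<Rightarrow> ('d torus \<times> (nat \<Rightarrow> 'd torus)) measure" where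
  "path_space \<mu> Q = \<mu> \<Otimes>\<^sub>M (\<Pi>\<^sub>M n\<in>{1..}. Q)"

primrec process ::
    "('d::finite torus \<Rightarrow> 'd torus) \<Rightarrow> nat \<Rightarrow> 'd torus \<times> (nat \<Rightarrow> 'd torus) \<Rightarrow> 'd torus" where
  "process \<phi> 0 \<omega> = fst \<omega>"
| "process \<phi> (Suc n) \<omega> = \<phi> (process \<phi> n \<omega>) + snd \<omega> (Suc n)"

definition process_dist ::
    "('d::finite torus \<Rightarrow> 'd torus) \<Rightarrow> 'd torus measure \<Rightarrow> 'd torus measure \<Rightarrow> nat \<Rightarrow> 'd torus measure"
  where "process_dist \<phi> Q \<mu> n = distr (path_space \<mu> Q) borel (process \<phi> n)"

definition tv_dist :: "'a measure \<Rightarrow> 'a measure \<Rightarrow> real" where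
  "tv_dist \<mu> \<nu> = (SUP A\<in>sets \<nu>. \<bar>measure \<mu> A - measure \<nu> A\<bar>)"

text \<open>The infimum is taken in the extended naturals: it is the minimum if the set is nonempty and
  \<open>\<infinity>\<close> otherwise, so a finite upper bound on the mixing time includes the claim that the process
  mixes.\<close>

definition mixing_time ::
    "('d::finite torus \<Rightarrow> 'd torus) \<Rightarrow> 'd torus measure \<Rightarrow> real \<Rightarrow> enat" where
  "mixing_time \<phi> Q \<delta> = Inf (enat ` {n. \<forall>\<mu>. prob_space \<mu> \<and> sets \<mu> = sets borel \<longrightarrow>
      tv_dist (process_dist \<phi> Q \<mu> n) torus_measure \<le> \<delta>})"

abbreviation t_mix :: "('d::finite torus \<Rightarrow> 'd torus) \<Rightarrow> 'd torus measure \<Rightarrow> enat" where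
  "t_mix \<phi> Q \<equiv> mixing_time \<phi> Q (1/2)"

section \<open>The noise\<close>

definition prob_density :: "(real^'d \<Rightarrow> real) \<Rightarrow> bool" where
  "prob_density K \<longleftrightarrow> K \<in> borel_measurable borel \<and> (\<forall>x. 0 \<le> K x) \<and>
     (\<integral>\<^sup>+ x. ennreal (K x) \<partial>lborel) = 1"

definition rescale :: "real \<Rightarrow> (real^'d \<Rightarrow> real) \<Rightarrow> real^'d \<Rightarrow> real" where
  "rescale \<epsilon> K x = K (x /\<^sub>R \<epsilon>) / \<epsilon> ^ CARD('d)"

text \<open>The sum is taken in \<open>ennreal\<close>, where it always exists; for a probability density \<open>K\<close> it is finite
  almost everywhere only.\<close>

definition periodize :: "(real^'d \<Rightarrow> real) \<Rightarrow> 'd::finite torus \<Rightarrow> ennreal" where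
  "periodize K x = (\<Sum>\<^sub>\<infinity>n\<in>{n. \<forall>j. n $ j \<in> \<int>}. ennreal (K (check x + n)))"

definition noise_law :: "(real^'d \<Rightarrow> real) \<Rightarrow> real \<Rightarrow> 'd::finite torus measure" where
  "noise_law K \<epsilon> = density torus_measure (periodize (rescale \<epsilon> K))"

section \<open>The piecewise affine map\<close>

text \<open>A product of intervals of the same positive length, with arbitrary endpoint conventions.\<close>

definition axis_cube :: "(real^'d) set \<Rightarrow> bool" where
  "axis_cube S \<longleftrightarrow> (\<exists>a r J. r > 0 \<and>
     (\<forall>j. {a $ j <..< a $ j + r} \<subseteq> J j \<and> J j \<subseteq> {a $ j .. a $ j + r}) \<and>
     S = {x. \<forall>j. x $ j \<in> J j})"

definition branch_affine ::
    "(nat \<Rightarrow> (real^'d) set) \<Rightarrow> (nat \<Rightarrow> real^'d^'d) \<Rightarrow> (nat \<Rightarrow> real^'d) \<Rightarrow> nat \<Rightarrow> real^'d \<Rightarrow> real^'d"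
  where "branch_affine E D e i x =
    (measure lborel (E i) powr (- 1 / real CARD('d))) *\<^sub>R (D i *v x) + e i"

definition bernoulli_data ::
    "nat \<Rightarrow> (nat \<Rightarrow> (real^'d) set) \<Rightarrow> (nat \<Rightarrow> real^'d^'d) \<Rightarrow> (nat \<Rightarrow> real^'d) \<Rightarrow> bool" where
  "bernoulli_data M E D e \<longleftrightarrow>
     2 \<le> M \<and>
     disjoint_family_on E {1..M} \<and> (\<Union>i\<in>{1..M}. E i) = unit_cube \<and>
     (\<forall>i\<in>{1..M}.
        (CARD('d) = 1 \<longrightarrow> is_interval (E i)) \<and>
        (CARD('d) > 1 \<longrightarrow> axis_cube (E i)) \<and>
        0 < measure lborel (E i) \<and> measure lborel (E i) < 1 \<and>
        orthogonal_matrix (D i) \<and>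
        bij_betw (branch_affine E D e i) (E i) unit_cube)"

definition branch ::
    "(nat \<Rightarrow> (real^'d) set) \<Rightarrow> (nat \<Rightarrow> real^'d^'d) \<Rightarrow> (nat \<Rightarrow> real^'d) \<Rightarrow> nat \<Rightarrow>
     'd::finite torus \<Rightarrow> 'd torus"
  where "branch E D e i x = proj (branch_affine E D e i (check x))"

definition bernoulli_map ::
    "nat \<Rightarrow> (nat \<Rightarrow> (real^'d) set) \<Rightarrow> (nat \<Rightarrow> real^'d^'d) \<Rightarrow> (nat \<Rightarrow> real^'d) \<Rightarrow>
     'd::finite torus \<Rightarrow> 'd torus"
  where "bernoulli_map M E D e x = branch E D e (THE i. i \<in> {1..M} \<and> x \<in> proj ` E i) x"

definition cylinder ::
    "nat \<Rightarrow> (nat \<Rightarrow> (real^'d) set) \<Rightarrow> (nat \<Rightarrow> real^'d^'d) \<Rightarrow> (nat \<Rightarrow> real^'d) \<Rightarrow> nat list \<Rightarrow>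
     'd::finite torus set"
  where "cylinder M E D e s = {x. \<forall>n<length s. (bernoulli_map M E D e ^^ n) x \<in> proj ` E (s ! n)}"

section \<open>The assumptions\<close>

definition cubes_assumption ::
    "nat \<Rightarrow> (nat \<Rightarrow> (real^'d) set) \<Rightarrow> (nat \<Rightarrow> real^'d^'d) \<Rightarrow> (nat \<Rightarrow> real^'d) \<Rightarrow> bool" where
  "cubes_assumption M E D e \<longleftrightarrow>
     (\<forall>i\<in>{1..M}. bij_betw (branch E D e i) (proj ` E i) UNIV) \<and>
     (\<forall>x\<in>frontier {x. \<forall>j. 0 \<le> x $ j \<and> x $ j \<le> 1}. \<exists>i\<in>{1..M}. \<exists>y.
        (\<forall>j. 0 < y $ j \<and> y $ j < 1) \<and> branch_affine E D e i y = x) \<and>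
     (CARD('d) \<ge> 2 \<longrightarrow> (\<forall>s. set s \<subseteq> {1..M} \<longrightarrow> axis_cube (check ` cylinder M E D e s)))"

definition rotation_invariant ::
    "nat \<Rightarrow> (nat \<Rightarrow> real^'d^'d) \<Rightarrow> (real^'d \<Rightarrow> real) \<Rightarrow> bool" where
  "rotation_invariant M D K \<longleftrightarrow> (\<forall>i\<in>{1..M}. \<forall>x. K (D i *v x) = K x)"

definition gaussian_density :: "real^'d^'d \<Rightarrow> real^'d \<Rightarrow> real" where
  "gaussian_density \<Sigma> x =
     exp (- (x \<bullet> (matrix_inv \<Sigma> *v x)) / 2) / sqrt ((2 * pi) ^ CARD('d) * det \<Sigma>)"

definition gaussian_assumption ::
    "nat \<Rightarrow> (nat \<Rightarrow> (real^'d) set) \<Rightarrow> (nat \<Rightarrow> real^'d^'d) \<Rightarrow> (nat \<Rightarrow> real^'d) \<Rightarrow>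
     (real^'d \<Rightarrow> real) \<Rightarrow> bool" where
  "gaussian_assumption M E D e K \<longleftrightarrow>
     cubes_assumption M E D e \<and>
     (\<exists>\<Sigma>. transpose \<Sigma> = \<Sigma> \<and> (\<forall>x. x \<noteq> 0 \<longrightarrow> 0 < x \<bullet> (\<Sigma> *v x)) \<and> K = gaussian_density \<Sigma>) \<and>
     rotation_invariant M D K"

definition separated_sum ::
    "(nat \<Rightarrow> nat \<Rightarrow> real) \<Rightarrow> (nat \<Rightarrow> nat \<Rightarrow> real \<Rightarrow> real) \<Rightarrow> nat \<Rightarrow> real^'d \<Rightarrow> real" where
  "separated_sum b k n x = (\<Sum>i=1..n. b n i * (\<Prod>j\<in>UNIV. k n i (x $ j)))"

definition separated_assumption ::
    "nat \<Rightarrow> (nat \<Rightarrow> (real^'d) set) \<Rightarrow> (nat \<Rightarrow> real^'d^'d) \<Rightarrow> (nat \<Rightarrow> real^'d) \<Rightarrow>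
     (real^'d \<Rightarrow> real) \<Rightarrow> bool" where
  "separated_assumption M E D e K \<longleftrightarrow>
     cubes_assumption M E D e \<and>
     prob_density K \<and>
     (\<forall>\<eta>>0. 0 < (INF (x, y) \<in> {x. \<forall>j. 0 \<le> x $ j \<and> x $ j < \<eta>} \<times> {y. \<forall>j. 0 \<le> y $ j \<and> y $ j < \<eta>}.
                  K (x - y))) \<and>
     (\<exists>b k.
        (\<forall>n\<ge>1. prob_density (separated_sum b k n :: real^'d \<Rightarrow> real)) \<and>
        (\<lambda>n. \<integral>\<^sup>+ x. ennreal \<bar>separated_sum b k n x - K x\<bar> \<partial>lborel) \<longlonglongrightarrow> 0 \<and>
        (\<forall>n\<ge>1. \<forall>i\<in>{1..n}. 0 \<le> b n i \<and> k n i \<in> borel_measurable borel \<and>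
           (\<forall>t. 0 \<le> k n i t) \<and> (\<forall>t. k n i (- t) = k n i t)) \<and>
        (\<exists>A>0. \<forall>n\<ge>1. \<forall>i\<in>{1..n}.
           (\<integral>\<^sup>+ t. ennreal (k n i t) \<partial>lborel) = 1 \<and>
           (\<integral>\<^sup>+ t. ennreal (\<bar>t\<bar> * k n i t) \<partial>lborel) \<le> ennreal A \<and>
           (\<integral>\<^sup>+ t\<in>{0..1/2}. ennreal (t * k n i t) \<partial>lborel) \<ge> ennreal (1 / A))) \<and>
     rotation_invariant M D K"

end

theory Submission
  imports Defs
begin

text \<open>
  The bound rests on a Doeblin minorization. Let \<open>\<phi>\<close> be the map and \<open>U\<^sub>s\<close> the uniform law on the
  cylinder of the word \<open>s\<close>. Because the branches are onto and affine, \<open>\<phi>\<close> sends \<open>U\<^sub>s\<close> exactly to the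
  uniform law on the cylinder of the shifted word, which is larger by a definite factor. Without noise,
  the uniform law on a cylinder of side comparable to \<open>\<epsilon>\<close> therefore becomes the uniform law on the torus
  after about \<open>\<bar>ln \<epsilon>\<bar>\<close> steps.

  The noise disturbs this little. A cylinder is a cube up to a rotation, and moving a cube of side \<open>l\<close> by a
  vector of length of order \<open>\<epsilon>\<close> changes its uniform law by \<open>O(\<epsilon> / l)\<close> in total variation
  (\<open>cyl_avg_step\<close>). Since the sides grow geometrically along the way, the errors sum to
  \<open>O(\<epsilon> / l\<^sub>0)\<close>, where \<open>l\<^sub>0\<close> is the side at the start (\<open>cyl_avg_iterate\<close>). With \<open>l\<^sub>0\<close> between \<open>\<rho> A \<epsilon>\<close> and
  \<open>A \<epsilon>\<close>, for the smallest branch ratio \<open>\<rho>\<close> and a large constant \<open>A\<close>, the total error is at most \<open>1 / 4\<close>.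

  To get started, note that the density of the noise is bounded below by a multiple of \<open>\<epsilon>\<^sup>-\<^sup>d\<close> on a ball
  whose radius is any fixed multiple of \<open>\<epsilon>\<close>. So after one step from any point, a fixed fraction of the
  mass is uniformly distributed on a cylinder of side about \<open>A \<epsilon>\<close> (\<open>L_ge_cyl_avg\<close>). Together this shows
  that after \<open>n + 1\<close> steps, with \<open>n\<close> of order \<open>\<bar>ln \<epsilon>\<bar>\<close>, a fixed fraction of the mass is within \<open>1 / 4\<close> of the
  stationary measure, uniformly in the starting point and in \<open>\<epsilon>\<close> (\<open>doeblin\<close>). Such a minorization
  contracts oscillations of observables by a fixed factor (\<open>minorization_imp_oscillation\<close>), so a fixed
  number of repetitions brings the distance to the stationary measure below \<open>1 / 2\<close>.

  What the argument asks of the noise is a density that is bounded below on every ball and has a finite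
  first moment. For the separated densities the lower bound is assumed and the moment bound passes to
  the limit of the approximating product densities; for the Gaussian both follow after diagonalizing
  the covariance matrix.
\<close>

section \<open>The torus as a quotient of Euclidean space\<close>

definition int_lattice :: "(real^'d) set" where
  "int_lattice = {n. \<forall>j. n $ j \<in> \<int>}"

lemma proj_eq_iff: "proj x = proj y \<longleftrightarrow> int_translate x y"
  by transfer simp

lemma proj_add: "proj x + proj y = proj (x + y)"
  by transfer (simp add: int_translate_def)

lemma proj_eq_iff_lattice: "proj x = proj y \<longleftrightarrow> x - y \<in> int_lattice"
  by (simp add: proj_eq_iff int_translate_def int_lattice_def)

lemma proj_lattice_add: "n \<in> int_lattice \<Longrightarrow> proj (x + n) = proj x"
  by (simp add: proj_eq_iff_lattice)

lemma ex1_lattice_translate: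
  fixes x :: "real^'d::finite"
  shows "\<exists>!n. n \<in> int_lattice \<and> x + n \<in> unit_cube"
proof
  show "(\<chi> j. - of_int \<lfloor>x $ j\<rfloor>) \<in> int_lattice \<and> x + (\<chi> j. - of_int \<lfloor>x $ j\<rfloor>) \<in> unit_cube"
    by (auto simp: int_lattice_def unit_cube_def) linarith
next
  fix n assume n: "n \<in> int_lattice \<and> x + n \<in> unit_cube"
  show "n = (\<chi> j. - of_int \<lfloor>x $ j\<rfloor>)"
  proof (simp add: vec_eq_iff, rule allI)
    fix j
    have "n $ j \<in> \<int>" "0 \<le> x $ j + n $ j" "x $ j + n $ j < 1"
      using n by (auto simp: int_lattice_def unit_cube_def)
    then obtain k where k: "n $ j = of_int k" by (auto elim: Ints_cases)
    then have "\<lfloor>x $ j\<rfloor> = - k"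
      using \<open>0 \<le> x $ j + n $ j\<close> \<open>x $ j + n $ j < 1\<close> by (intro floor_unique) auto
    then show "n $ j = - of_int \<lfloor>x $ j\<rfloor>" using k by simp
  qed
qed

lemma zero_in_int_lattice [simp]: "0 \<in> int_lattice"
  by (simp add: int_lattice_def)

lemma proj_inj_on_unit_cube:
  assumes "x \<in> unit_cube" "y \<in> unit_cube" "proj x = proj y"
  shows "x = y"
proof -
  have "x - y \<in> int_lattice" using assms(3) by (simp add: proj_eq_iff_lattice)
  then show ?thesis
    using ex1_lattice_translate[of y] assms(1,2)
    by (metis add.commute add.right_neutral diff_add_cancel diff_self zero_in_int_lattice)
qed

lemma proj_surj_unit_cube: "\<exists>y\<in>unit_cube. proj y = (x :: 'd::finite torus)"
proof -
  obtain z where "x = proj z" by (metis proj.abs_eq Quotient3_abs_rep[OF Quotient3_torus])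
  moreover obtain n where "n \<in> int_lattice" "z + n \<in> unit_cube"
    using ex1_lattice_translate[of z] by blast
  ultimately show ?thesis using proj_lattice_add by metis
qed

lemma check_props: "check x \<in> unit_cube" "proj (check x) = x"
proof -
  have "check x \<in> unit_cube \<and> proj (check x) = x"
    unfolding check_def by (rule theI') (use proj_surj_unit_cube proj_inj_on_unit_cube in metis)
  then show "check x \<in> unit_cube" "proj (check x) = x" by auto
qed

lemma check_proj: "y \<in> unit_cube \<Longrightarrow> check (proj y) = y"
  using proj_inj_on_unit_cube check_props by blast

lemma plus_eq_proj_check: "x + y = proj (check x + check y)"
  by (metis check_props(2) proj_add)

lemma continuous_on_proj: "continuous_on UNIV (proj :: real^'d \<Rightarrow> 'd::finite torus)"
  by (simp add: continuous_on_open_vimage open_torus_def)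

lemma measurable_proj [measurable]: "proj \<in> borel_measurable borel"
  by (rule borel_measurable_continuous_onI[OF continuous_on_proj])

lemma borel_measurable_vec_nth' [measurable]: "(\<lambda>x::real^'d::finite. x $ j) \<in> borel_measurable borel"
  by (intro borel_measurable_continuous_onI continuous_intros)

lemma sets_unit_cube [measurable]: "(unit_cube :: (real^'d::finite) set) \<in> sets borel"
  unfolding unit_cube_def by measurable

lemma closed_int_lattice: "closed (int_lattice :: (real^'d::finite) set)"
proof -
  have eq: "int_lattice = (\<Inter>j. (\<lambda>x::real^'d. x $ j) -` \<int>)" by (auto simp: int_lattice_def)
  have "closed ((\<lambda>x::real^'d. x $ j) -` \<int>)" for j
    by (intro continuous_closed_vimage closed_Ints continuous_intros)
  then show ?thesis unfolding eq by (intro closed_INT ballI)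
qed

text \<open>The preimage of \<open>proj ` F\<close> is the sum of the compact set \<open>F\<close> and the closed lattice, and such sums are
closed.\<close>

lemma closed_proj_compact:
  fixes F :: "(real^'d::finite) set"
  assumes "compact F"
  shows "closed (proj ` F)"
proof -
  have "proj -` (proj ` F) = (\<Union>x\<in>F. \<Union>n\<in>int_lattice. {x + n})"
    by (force simp: proj_eq_iff_lattice image_iff intro: proj_lattice_add[symmetric])
  then have "closed (proj -` (proj ` F))"
    using compact_closed_sums[OF assms closed_int_lattice] by simp
  then show ?thesis
    by (simp add: closed_def open_torus_def vimage_Compl)
qed

text \<open>The half-open cube is a countable union of compact boxes, and the projection of a compact set is
closed. Hence the preimage of a closed set under \<open>check\<close>, which is the projection of a subset of the
half-open cube, is a countable union of closed sets. In particular \<open>check\<close> is Borel although it is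
discontinuous.\<close>

lemma measurable_check [measurable]: "(check :: 'd::finite torus \<Rightarrow> real^'d) \<in> borel_measurable borel"
proof -
  have "check -` F \<in> sets borel" if F: "closed F" for F :: "(real^'d) set"
  proof -
    define B :: "nat \<Rightarrow> (real^'d) set" where "B k = cbox 0 (\<chi> j. 1 - 1 / Suc k)" for k
    have cube: "unit_cube = (\<Union>k. B k)"
    proof (intro set_eqI iffI)
      fix x :: "real^'d" assume x: "x \<in> unit_cube"
      define m where "m = Max (range (\<lambda>j. x $ j))"
      have "m \<in> range (\<lambda>j. x $ j)" unfolding m_def by (intro Max_in) auto
      then have "m < 1" using x by (auto simp: unit_cube_def)
      then obtain k where "1 / Suc k < 1 - m"
        by (metis inverse_eq_divide diff_gt_0_iff_gt reals_Archimedean)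
      moreover have "x $ j \<le> m" for j unfolding m_def by (intro Max_ge) auto
      ultimately have "x \<in> B k" using x
        by (fastforce simp: B_def mem_box_cart unit_cube_def intro: order.trans)
      then show "x \<in> (\<Union>k. B k)" by blast
    next
      fix x :: "real^'d" assume "x \<in> (\<Union>k. B k)"
      then obtain k where k: "x \<in> B k" by auto
      have "1 - 1 / real (Suc k) < 1" by simp
      then show "x \<in> unit_cube" using k unfolding B_def mem_box_cart unit_cube_def by (auto intro: le_less_trans)
    qed
    have "check -` F = proj ` (F \<inter> unit_cube)"
    proof (intro set_eqI iffI)
      fix x assume "x \<in> check -` F"
      then show "x \<in> proj ` (F \<inter> unit_cube)"
        by (intro image_eqI[of _ _ "check x"]) (simp_all add: check_props)
    qed (auto simp: check_proj)
    also have "\<dots> = (\<Union>k. proj ` (F \<inter> B k))" by (auto simp: cube)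
    also have "\<dots> \<in> sets borel"
    proof (rule sets.countable_UN)
      have "compact (F \<inter> B k)" for k
        unfolding B_def by (rule closed_Int_compact[OF F compact_cbox])
      then show "range (\<lambda>k. proj ` (F \<inter> B k)) \<subseteq> sets borel"
        by (auto intro!: borel_closed closed_proj_compact)
    qed
    finally show ?thesis .
  qed
  then show ?thesis
    unfolding borel_eq_closed
    by (intro measurable_measure_of) (auto simp: borel_eq_closed[symmetric])
qed

lemma measurable_torus_plus [measurable (raw)]:
  fixes f g :: "'a \<Rightarrow> 'd::finite torus"
  assumes [measurable]: "f \<in> borel_measurable N" "g \<in> borel_measurable N"
  shows "(\<lambda>x. f x + g x) \<in> borel_measurable N"
  unfolding plus_eq_proj_check by measurable

section \<open>Tiling Euclidean space by the unit cube\<close>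

lemma nn_integral_lborel_translate:
  fixes f :: "'a::euclidean_space \<Rightarrow> ennreal"
  assumes [measurable]: "f \<in> borel_measurable borel"
  shows "(\<integral>\<^sup>+x. f (x + a) \<partial>lborel) = (\<integral>\<^sup>+x. f x \<partial>lborel)"
  by (subst (2) lborel_affine[of 1 a]) (simp_all add: nn_integral_density nn_integral_distr add.commute)

lemma nn_integral_lborel_reflect:
  fixes f :: "'a::euclidean_space \<Rightarrow> ennreal"
  assumes [measurable]: "f \<in> borel_measurable borel"
  shows "(\<integral>\<^sup>+x. f (- x) \<partial>lborel) = (\<integral>\<^sup>+x. f x \<partial>lborel)"
  by (subst (2) lborel_affine[of "-1" 0]) (simp_all add: nn_integral_density nn_integral_distr)

lemma nn_integral_lborel_scale:
  fixes f :: "'a::euclidean_space \<Rightarrow> ennreal"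
  assumes [measurable]: "f \<in> borel_measurable borel" and "0 < c"
  shows "(\<integral>\<^sup>+x. f x \<partial>lborel) = ennreal (c ^ DIM('a)) * (\<integral>\<^sup>+x. f (c *\<^sub>R x) \<partial>lborel)"
  by (subst lborel_affine[of c 0]) (use \<open>0 < c\<close> in \<open>simp_all add: nn_integral_density nn_integral_distr nn_integral_cmult\<close>)

lemma countable_int_lattice: "countable (int_lattice :: (real^'d::finite) set)"
proof -
  have "int_lattice \<subseteq> range (\<lambda>f::'d \<Rightarrow> int. (\<chi> j. of_int (f j)) :: real^'d)"
  proof
    fix n :: "real^'d" assume "n \<in> int_lattice"
    then have "n = (\<chi> j. of_int \<lfloor>n $ j\<rfloor>)" by (auto simp: int_lattice_def vec_eq_iff)
    then show "n \<in> range (\<lambda>f::'d \<Rightarrow> int. (\<chi> j. of_int (f j)) :: real^'d)"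
      by (intro image_eqI[of _ _ "\<lambda>j. \<lfloor>n $ j\<rfloor>"]) auto
  qed
  then show ?thesis by (rule countable_subset) simp
qed

lemma infsum_eq_nn_integral_count_space:
  fixes f :: "'a \<Rightarrow> ennreal"
  assumes "countable A"
  shows "infsum f A = (\<integral>\<^sup>+x. f x \<partial>count_space A)"
proof (cases "finite A")
  case True
  then show ?thesis by (simp add: nn_integral_count_space_finite)
next
  case False
  define g where "g = from_nat_into A"
  have bij: "bij_betw g UNIV A" unfolding g_def by (rule bij_betw_from_nat_into[OF assms False])
  have "infsum f A = (\<Sum>\<^sub>\<infinity>n. f (g n))"
    using infsum_reindex_bij_betw[OF bij, of f] by simp
  also have "\<dots> = (\<Sum>n. f (g n))"
    by (rule sums_unique) (use has_sum_imp_sums[of "\<lambda>n. f (g n)"] nonneg_summable_on_complete[of UNIV "\<lambda>n. f (g n)"] in \<open>auto simp: has_sum_infsum\<close>)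
  also have "\<dots> = (\<integral>\<^sup>+n. f (g n) \<partial>count_space UNIV)"
    by (simp add: nn_integral_count_space_nat)
  also have "\<dots> = (\<integral>\<^sup>+x. f x \<partial>count_space A)"
    by (rule nn_integral_bij_count_space[OF bij])
  finally show ?thesis .
qed

lemma nn_integral_lattice_unit_cube:
  fixes x :: "real^'d::finite"
  shows "(\<integral>\<^sup>+n. indicator unit_cube (x + n) \<partial>count_space int_lattice) = (1::ennreal)"
    and "(\<integral>\<^sup>+n. indicator unit_cube (x - n) \<partial>count_space int_lattice) = (1::ennreal)"
proof -
  obtain m where m: "m \<in> int_lattice" "x + m \<in> unit_cube"
    and u: "\<And>n. n \<in> int_lattice \<Longrightarrow> x + n \<in> unit_cube \<Longrightarrow> n = m"
    using ex1_lattice_translate[of x] by blast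
  have neg: "n \<in> int_lattice \<Longrightarrow> - n \<in> int_lattice" for n :: "real^'d"
    by (simp add: int_lattice_def)
  have "(\<integral>\<^sup>+n. indicator unit_cube (x + n) \<partial>count_space int_lattice) = (\<Sum>n\<in>{m}. indicator unit_cube (x + n) :: ennreal)"
  proof (rule nn_integral_count_space')
    fix n assume "n \<in> int_lattice" "n \<notin> {m}"
    then show "indicator unit_cube (x + n) = (0::ennreal)"
      using u[of n] by (auto simp: indicator_def)
  qed (use m in auto)
  then show "(\<integral>\<^sup>+n. indicator unit_cube (x + n) \<partial>count_space int_lattice) = (1::ennreal)" using m by simp
  have "(\<integral>\<^sup>+n. indicator unit_cube (x - n) \<partial>count_space int_lattice) = (\<Sum>n\<in>{-m}. indicator unit_cube (x - n) :: ennreal)"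
  proof (rule nn_integral_count_space')
    fix n assume "n \<in> int_lattice" "n \<notin> {-m}"
    then show "indicator unit_cube (x - n) = (0::ennreal)"
      using u[of "-n"] neg[of n] by (auto simp: indicator_def)
  qed (use m neg in auto)
  then show "(\<integral>\<^sup>+n. indicator unit_cube (x - n) \<partial>count_space int_lattice) = (1::ennreal)" using m by simp
qed

text \<open>The lattice translates of the half-open cube partition the space. This converts the periodized sum in
the law of the noise into an integral over the whole space, and it also yields the translation
invariance of the measure on the torus.\<close>

lemma nn_integral_tiling:
  fixes G :: "real^'d::finite \<Rightarrow> ennreal"
  assumes [measurable]: "G \<in> borel_measurable borel"
  shows "(\<integral>\<^sup>+u. (\<integral>\<^sup>+n. G (u + n) \<partial>count_space int_lattice) * indicator unit_cube u \<partial>lborel)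
       = (\<integral>\<^sup>+x. G x \<partial>lborel)"
proof -
  have "(\<integral>\<^sup>+u. (\<integral>\<^sup>+n. G (u + n) \<partial>count_space int_lattice) * indicator unit_cube u \<partial>lborel)
      = (\<integral>\<^sup>+u. (\<integral>\<^sup>+n. G (u + n) * indicator unit_cube u \<partial>count_space int_lattice) \<partial>lborel)"
    by (simp add: nn_integral_multc)
  also have "\<dots> = (\<integral>\<^sup>+n. (\<integral>\<^sup>+u. G (u + n) * indicator unit_cube u \<partial>lborel) \<partial>count_space int_lattice)"
    by (rule nn_integral_count_space_nn_integral[OF countable_int_lattice]) measurable
  also have "\<dots> = (\<integral>\<^sup>+n. (\<integral>\<^sup>+x. G x * indicator unit_cube (x - n) \<partial>lborel) \<partial>count_space int_lattice)"
  proof (rule nn_integral_cong)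
    fix n :: "real^'d"
    show "(\<integral>\<^sup>+u. G (u + n) * indicator unit_cube u \<partial>lborel) = (\<integral>\<^sup>+x. G x * indicator unit_cube (x - n) \<partial>lborel)"
      using nn_integral_lborel_translate[of "\<lambda>x. G x * indicator unit_cube (x - n)" n] by simp
  qed
  also have "\<dots> = (\<integral>\<^sup>+x. (\<integral>\<^sup>+n. G x * indicator unit_cube (x - n) \<partial>count_space int_lattice) \<partial>lborel)"
    by (rule nn_integral_count_space_nn_integral[OF countable_int_lattice, symmetric]) measurable
  also have "\<dots> = (\<integral>\<^sup>+x. G x \<partial>lborel)"
    by (simp add: nn_integral_cmult nn_integral_lattice_unit_cube)
  finally show ?thesis .
qed

lemma nn_integral_torus:
  fixes h :: "'d::finite torus \<Rightarrow> ennreal"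
  assumes [measurable]: "h \<in> borel_measurable borel"
  shows "(\<integral>\<^sup>+x. h x \<partial>torus_measure) = (\<integral>\<^sup>+u. h (proj u) * indicator unit_cube u \<partial>lborel)"
proof -
  have "proj \<in> restrict_space lborel unit_cube \<rightarrow>\<^sub>M borel"
    by (intro measurable_restrict_space1) simp
  then show ?thesis
    unfolding torus_measure_def
    by (subst nn_integral_distr) (simp_all add: nn_integral_restrict_space)
qed

lemma sets_torus_measure [measurable_cong, simp]: "sets torus_measure = sets borel"
  and space_torus_measure [simp]: "space torus_measure = UNIV"
  by (simp_all add: torus_measure_def)

lemma unit_cube_measure: "emeasure lborel (unit_cube :: (real^'d::finite) set) = 1"
proof -
  have "emeasure lborel (unit_cube :: (real^'d) set) = (\<integral>\<^sup>+x. (\<Prod>b\<in>Basis. indicator {0..<1} (x \<bullet> b)) \<partial>(lborel :: (real^'d) measure))"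
    by (subst nn_integral_indicator[symmetric], simp)
       (intro nn_integral_cong, auto simp: unit_cube_def Basis_vec_def cart_eq_inner_axis axis_eq_axis inj_on_def prod.UNION_disjoint indicator_def)
  also have "\<dots> = (\<Prod>b\<in>(Basis :: (real^'d) set). (\<integral>\<^sup>+x. indicator {0..<1} x \<partial>(lborel :: real measure)))"
    by (rule nn_integral_lborel_prod) auto
  finally show ?thesis by simp
qed

lemma prob_space_torus_measure: "prob_space torus_measure"
  using nn_integral_torus[of "\<lambda>_. 1"] by (intro prob_spaceI) (simp add: unit_cube_measure)

lemma density_periodize:
  fixes K :: "real^'d::finite \<Rightarrow> real"
  assumes [measurable]: "K \<in> borel_measurable borel"
  shows "density torus_measure (periodize K) = distr (density lborel K) borel proj"
proof (rule measure_eqI)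
  have per: "periodize K x = (\<integral>\<^sup>+n. K (check x + n) \<partial>count_space int_lattice)" for x
    unfolding periodize_def using infsum_eq_nn_integral_count_space[OF countable_int_lattice]
    by (simp add: int_lattice_def)
  interpret L: sigma_finite_measure "count_space (int_lattice :: (real^'d) set)"
    by (rule sigma_finite_measure_count_space_countable[OF countable_int_lattice])
  have meas: "periodize K \<in> borel_measurable borel"
    unfolding per[abs_def]
    by (intro L.borel_measurable_nn_integral, subst measurable_pair_swap_iff,
        intro measurable_pair_measure_countable1 countable_int_lattice) simp
  fix A assume "A \<in> sets (density torus_measure (periodize K))"
  then have A [measurable]: "A \<in> sets borel" by simp
  have "emeasure (density torus_measure (periodize K)) A = (\<integral>\<^sup>+x. periodize K x * indicator A x \<partial>torus_measure)"
    using meas by (simp add: emeasure_density)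
  also have "\<dots> = (\<integral>\<^sup>+u. periodize K (proj u) * indicator A (proj u) * indicator unit_cube u \<partial>lborel)"
    using meas by (subst nn_integral_torus) simp_all
  also have "\<dots> = (\<integral>\<^sup>+u. (\<integral>\<^sup>+n. ennreal (K (u + n)) * indicator A (proj (u + n)) \<partial>count_space int_lattice) * indicator unit_cube u \<partial>lborel)"
  proof (rule nn_integral_cong)
    fix u :: "real^'d"
    show "periodize K (proj u) * indicator A (proj u) * indicator unit_cube u
        = (\<integral>\<^sup>+n. ennreal (K (u + n)) * indicator A (proj (u + n)) \<partial>count_space int_lattice) * indicator unit_cube u"
    proof (cases "u \<in> unit_cube")
      case True
      have "(\<integral>\<^sup>+n. ennreal (K (u + n)) * indicator A (proj (u + n)) \<partial>count_space int_lattice)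
          = (\<integral>\<^sup>+n. ennreal (K (u + n)) * indicator A (proj u) \<partial>count_space int_lattice)"
        by (intro nn_integral_cong) (simp add: proj_lattice_add)
      then show ?thesis using True by (simp add: per check_proj nn_integral_multc)
    qed simp
  qed
  also have "\<dots> = (\<integral>\<^sup>+x. ennreal (K x) * indicator A (proj x) \<partial>lborel)"
    by (rule nn_integral_tiling) measurable
  also have "\<dots> = emeasure (distr (density lborel K) borel proj) A"
    by (simp add: emeasure_distr emeasure_density indicator_vimage[symmetric] measurable_sets_borel[OF measurable_proj])
  finally show "emeasure (density torus_measure (periodize K)) A = emeasure (distr (density lborel K) borel proj) A" .
qed simp

text \<open>The noise on the torus is the projection of \<open>\<epsilon>\<close> times a random vector with density \<open>K\<close>. All later
estimates use the noise in this form, where no lattice sum appears.\<close>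

lemma noise_law_eq_distr:
  fixes K :: "real^'d::finite \<Rightarrow> real"
  assumes [measurable]: "K \<in> borel_measurable borel" and "\<And>x. 0 \<le> K x" and "0 < \<epsilon>"
  shows "noise_law K \<epsilon> = distr (density lborel K) borel (\<lambda>w. proj (\<epsilon> *\<^sub>R w))"
proof -
  have [measurable]: "rescale \<epsilon> K \<in> borel_measurable borel"
    unfolding rescale_def[abs_def] by measurable
  have "noise_law K \<epsilon> = distr (density lborel (rescale \<epsilon> K)) borel proj"
    unfolding noise_law_def by (rule density_periodize) measurable
  also have "\<dots> = distr (density lborel K) borel (\<lambda>w. proj (\<epsilon> *\<^sub>R w))"
  proof (rule measure_eqI)
    fix A assume "A \<in> sets (distr (density lborel (rescale \<epsilon> K)) borel proj)"
    then have A [measurable]: "A \<in> sets borel" by simp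
    have "emeasure (distr (density lborel (rescale \<epsilon> K)) borel proj) A = (\<integral>\<^sup>+x. ennreal (rescale \<epsilon> K x) * indicator A (proj x) \<partial>lborel)"
      by (simp add: emeasure_distr emeasure_density indicator_vimage[symmetric] measurable_sets_borel[OF measurable_proj])
    also have "\<dots> = ennreal (\<epsilon> ^ CARD('d)) * (\<integral>\<^sup>+x. ennreal (rescale \<epsilon> K (\<epsilon> *\<^sub>R x)) * indicator A (proj (\<epsilon> *\<^sub>R x)) \<partial>lborel)"
      by (subst nn_integral_lborel_scale[OF _ \<open>0 < \<epsilon>\<close>]) (simp_all, measurable)
    also have "\<dots> = (\<integral>\<^sup>+x. ennreal (K x) * indicator A (proj (\<epsilon> *\<^sub>R x)) \<partial>lborel)"
      using assms(2) \<open>0 < \<epsilon>\<close>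
      by (subst nn_integral_cmult[symmetric])
         (auto intro!: nn_integral_cong simp: rescale_def mult.assoc[symmetric] ennreal_mult[symmetric])
    also have "\<dots> = emeasure (distr (density lborel K) borel (\<lambda>w. proj (\<epsilon> *\<^sub>R w))) A"
      by (simp add: emeasure_distr emeasure_density indicator_vimage[symmetric] measurable_sets_borel vimage_def) 
    finally show "emeasure (distr (density lborel (rescale \<epsilon> K)) borel proj) A
      = emeasure (distr (density lborel K) borel (\<lambda>w. proj (\<epsilon> *\<^sub>R w))) A" .
  qed simp
  finally show ?thesis .
qed

lemma nn_integral_torus_translate:
  fixes h :: "'d::finite torus \<Rightarrow> ennreal"
  assumes [measurable]: "h \<in> borel_measurable borel"
  shows "(\<integral>\<^sup>+x. h (x + proj a) \<partial>torus_measure) = (\<integral>\<^sup>+x. h x \<partial>torus_measure)"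
proof -
  have "(\<integral>\<^sup>+x. h (x + proj a) \<partial>torus_measure) = (\<integral>\<^sup>+u. h (proj (u + a)) * indicator unit_cube u \<partial>lborel)"
    by (subst nn_integral_torus) (simp_all add: proj_add)
  also have "\<dots> = (\<integral>\<^sup>+u. h (proj u) * indicator unit_cube (u - a) \<partial>lborel)"
    using nn_integral_lborel_translate[of "\<lambda>u. h (proj u) * indicator unit_cube (u - a)" a] by simp
  also have "\<dots> = (\<integral>\<^sup>+u. (\<integral>\<^sup>+n. h (proj (u + n)) * indicator unit_cube (u + n - a) \<partial>count_space int_lattice) * indicator unit_cube u \<partial>lborel)"
    by (rule nn_integral_tiling[symmetric]) measurable
  also have "\<dots> = (\<integral>\<^sup>+u. h (proj u) * indicator unit_cube u \<partial>lborel)"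
  proof (intro nn_integral_cong arg_cong2[of _ _ _ _ "(*)"] refl)
    fix u :: "real^'d"
    have "(\<integral>\<^sup>+n. h (proj (u + n)) * indicator unit_cube (u + n - a) \<partial>count_space int_lattice)
        = (\<integral>\<^sup>+n. h (proj u) * indicator unit_cube ((u - a) + n) \<partial>count_space int_lattice)"
      by (intro nn_integral_cong) (simp add: proj_lattice_add diff_add_eq)
    also have "\<dots> = h (proj u)" by (simp add: nn_integral_cmult nn_integral_lattice_unit_cube)
    finally show "(\<integral>\<^sup>+n. h (proj (u + n)) * indicator unit_cube (u + n - a) \<partial>count_space int_lattice) = h (proj u)" .
  qed
  also have "\<dots> = (\<integral>\<^sup>+x. h x \<partial>torus_measure)" by (rule nn_integral_torus[symmetric]) measurable
  finally show ?thesis .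
qed

section \<open>Similarities and translates of the unit cube\<close>

text \<open>Uniqueness of Haar measure, in the special case at hand. The image of Lebesgue measure under an
orthogonal map is translation invariant, so that integrating \<open>f (T x) * indicator B (y + T x)\<close> in
both orders shows that it is a multiple of Lebesgue measure. The factor is 1 because \<open>T\<close> preserves the
unit ball \<open>B\<close>.\<close>

lemma nn_integral_lborel_orthogonal:
  fixes T :: "'a::euclidean_space \<Rightarrow> 'a" and f :: "'a \<Rightarrow> ennreal"
  assumes T: "orthogonal_transformation T" and [measurable]: "f \<in> borel_measurable borel"
  shows "(\<integral>\<^sup>+x. f (T x) \<partial>lborel) = (\<integral>\<^sup>+x. f x \<partial>lborel)"
proof -
  have lin: "linear T" using T by (rule orthogonal_transformation_linear)
  then have [measurable]: "T \<in> borel_measurable borel"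
    by (intro borel_measurable_continuous_onI linear_continuous_on linear_conv_bounded_linear[THEN iffD1])
  obtain S where S: "\<And>y. T (S y) = y"
    using orthogonal_transformation_surj[OF T] by (metis surj_def)
  define B :: "'a set" where "B = ball 0 1"
  have [measurable]: "B \<in> sets borel" by (simp add: B_def)
  have TB: "indicator B (T x) = (indicator B x :: ennreal)" for x
    using orthogonal_transformation_norm[OF T, of x] by (simp add: B_def indicator_def)
  have "(\<integral>\<^sup>+x. f (T x) \<partial>lborel) * emeasure lborel B = (\<integral>\<^sup>+x. f (T x) * (\<integral>\<^sup>+y. indicator B y \<partial>lborel) \<partial>lborel)"
    by (simp add: nn_integral_multc)
  also have "\<dots> = (\<integral>\<^sup>+x. f (T x) * (\<integral>\<^sup>+y. indicator B (y + T x) \<partial>lborel) \<partial>lborel)"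
    by (subst nn_integral_lborel_translate) simp_all
  also have "\<dots> = (\<integral>\<^sup>+x. (\<integral>\<^sup>+y. f (T x) * indicator B (y + T x) \<partial>lborel) \<partial>lborel)"
    by (simp add: nn_integral_cmult)
  also have "\<dots> = (\<integral>\<^sup>+y. (\<integral>\<^sup>+x. f (T x) * indicator B (y + T x) \<partial>lborel) \<partial>lborel)"
    by (rule lborel_pair.Fubini'[symmetric]) measurable
  \<comment> \<open>Replace \<open>x\<close> by \<open>x - S y\<close>, so that \<open>T x\<close> becomes \<open>T x - y\<close>.\<close>
  also have "\<dots> = (\<integral>\<^sup>+y. (\<integral>\<^sup>+x. f (T x - y) * indicator B (T x) \<partial>lborel) \<partial>lborel)"
  proof (rule nn_integral_cong)
    fix y
    show "(\<integral>\<^sup>+x. f (T x) * indicator B (y + T x) \<partial>lborel) = (\<integral>\<^sup>+x. f (T x - y) * indicator B (T x) \<partial>lborel)"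
      using nn_integral_lborel_translate[of "\<lambda>x. f (T x - y) * indicator B (T x)" "S y"]
      by (simp add: linear_add[OF lin] S add.commute)
  qed
  also have "\<dots> = (\<integral>\<^sup>+x. (\<integral>\<^sup>+y. f (T x - y) * indicator B (T x) \<partial>lborel) \<partial>lborel)"
    by (rule lborel_pair.Fubini') measurable
  also have "\<dots> = (\<integral>\<^sup>+x. (\<integral>\<^sup>+y. f (T x - y) \<partial>lborel) * indicator B (T x) \<partial>lborel)"
    by (simp add: nn_integral_multc)
  also have "\<dots> = (\<integral>\<^sup>+x. (\<integral>\<^sup>+y. f y \<partial>lborel) * indicator B (T x) \<partial>lborel)"
  proof (rule nn_integral_cong)
    fix x
    show "(\<integral>\<^sup>+y. f (T x - y) \<partial>lborel) * indicator B (T x) = (\<integral>\<^sup>+y. f y \<partial>lborel) * indicator B (T x)"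
      using nn_integral_lborel_translate[of f "T x"] nn_integral_lborel_reflect[of "\<lambda>y. f (y + T x)"]
      by (simp add: add.commute)
  qed
  also have "\<dots> = (\<integral>\<^sup>+x. f x \<partial>lborel) * emeasure lborel B"
    by (simp add: TB nn_integral_cmult)
  finally have "(\<integral>\<^sup>+x. f (T x) \<partial>lborel) * emeasure lborel B = (\<integral>\<^sup>+x. f x \<partial>lborel) * emeasure lborel B" .
  moreover have "emeasure lborel B \<noteq> 0"
  proof
    assume "emeasure lborel B = 0"
    then have "B \<in> null_sets lborel" by (simp add: null_sets_def)
    then show False unfolding B_def using open_not_negligible[of "ball (0::'a) 1"]
      by (simp add: negligible_iff_null_sets null_sets_completionI)
  qed
  moreover have "emeasure lborel B \<noteq> \<infinity>"
    unfolding B_def using emeasure_lborel_ball_finite[of "0::'a" 1] by simp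
  ultimately show ?thesis
    by (metis ennreal_mult_divide_eq infinity_ennreal_def)
qed

lemma nn_integral_similarity:
  fixes F :: "real^'d::finite \<Rightarrow> ennreal" and T :: "real^'d \<Rightarrow> real^'d"
  assumes T: "orthogonal_transformation T" and [measurable]: "F \<in> borel_measurable borel" and r: "0 < r"
  shows "(\<integral>\<^sup>+y. F y \<partial>lborel) = ennreal (r ^ CARD('d)) * (\<integral>\<^sup>+u. F (r *\<^sub>R T (u - a)) \<partial>lborel)"
proof -
  have [measurable]: "T \<in> borel_measurable borel"
    using orthogonal_transformation_linear[OF T]
    by (intro borel_measurable_continuous_onI linear_continuous_on linear_conv_bounded_linear[THEN iffD1])
  have "(\<integral>\<^sup>+y. F y \<partial>lborel) = ennreal (r ^ CARD('d)) * (\<integral>\<^sup>+u. F (r *\<^sub>R u) \<partial>lborel)"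
    using nn_integral_lborel_scale[of F r] r by simp
  also have "(\<integral>\<^sup>+u. F (r *\<^sub>R u) \<partial>lborel) = (\<integral>\<^sup>+u. F (r *\<^sub>R T u) \<partial>lborel)"
    by (rule nn_integral_lborel_orthogonal[OF T, symmetric]) measurable
  also have "\<dots> = (\<integral>\<^sup>+u. F (r *\<^sub>R T (u - a)) \<partial>lborel)"
    using nn_integral_lborel_translate[of "\<lambda>u. F (r *\<^sub>R T u)" "- a"] by simp
  finally show ?thesis .
qed

text \<open>The points of the cube that leave it in the direction of coordinate \<open>j\<close> under a shift by \<open>t\<close> form a slab
of thickness at most \<open>\<bar>t\<bar>\<close>.\<close>

lemma unit_cube_slab:
  fixes j :: "'d::finite" and t :: real
  shows "emeasure lborel {u \<in> unit_cube :: (real^'d) set. \<not> (0 \<le> u $ j + t \<and> u $ j + t < 1)} \<le> ennreal \<bar>t\<bar>"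
proof (cases "\<bar>t\<bar> < 1")
  case True
  define J where "J = (if 0 \<le> t then {1 - t..1} else {0..-t})"
  have "emeasure lborel {u \<in> unit_cube :: (real^'d) set. \<not> (0 \<le> u $ j + t \<and> u $ j + t < 1)}
      \<le> (\<integral>\<^sup>+u. (\<Prod>b\<in>Basis. indicator (if b = axis j 1 then J else {0..1}) (u \<bullet> b)) \<partial>(lborel :: (real^'d) measure))"
  proof -
    let ?S = "{u \<in> unit_cube :: (real^'d) set. \<not> (0 \<le> u $ j + t \<and> u $ j + t < 1)}"
    have ind: "indicator ?S u \<le> (\<Prod>b\<in>Basis. indicator (if b = axis j 1 then J else {0..1}) (u \<bullet> b) :: ennreal)" for u
    proof (cases "u \<in> ?S")
      case True
      then have "u \<bullet> b \<in> (if b = axis j 1 then J else {0..1})" if "b \<in> Basis" for b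
        using that \<open>\<bar>t\<bar> < 1\<close>
        by (auto simp: Basis_vec_def J_def unit_cube_def inner_axis axis_eq_axis intro: less_imp_le)
           (smt (verit))
      then have "(\<Prod>b\<in>Basis. indicator (if b = axis j 1 then J else {0..1}) (u \<bullet> b) :: ennreal) = 1"
        by simp
      then show ?thesis by (simp add: indicator_def)
    qed simp
    have "(\<integral>\<^sup>+u. indicator ?S u \<partial>lborel)
        \<le> (\<integral>\<^sup>+u. (\<Prod>b\<in>Basis. indicator (if b = axis j 1 then J else {0..1}) (u \<bullet> b)) \<partial>(lborel :: (real^'d) measure))"
      by (intro nn_integral_mono ind)
    moreover have "?S \<in> sets lborel" by measurable
    ultimately show ?thesis by (simp only: nn_integral_indicator)
  qed
  also have "\<dots> = (\<Prod>b\<in>(Basis::(real^'d) set). (\<integral>\<^sup>+x. indicator (if b = axis j 1 then J else {0..1}) x \<partial>(lborel :: real measure)))"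
    by (rule nn_integral_lborel_prod) (auto simp: J_def)
  also have "\<dots> = (\<Prod>b\<in>(Basis::(real^'d) set). (if b = axis j 1 then ennreal \<bar>t\<bar> else 1))"
    by (intro prod.cong refl) (auto simp: J_def)
  also have "\<dots> = ennreal \<bar>t\<bar>"
    by (simp add: prod.delta axis_in_Basis_iff)
  finally show ?thesis .
next
  case False
  have "emeasure lborel {u \<in> unit_cube :: (real^'d) set. \<not> (0 \<le> u $ j + t \<and> u $ j + t < 1)} \<le> emeasure lborel (unit_cube :: (real^'d) set)"
    by (rule emeasure_mono) auto
  also have "\<dots> \<le> ennreal \<bar>t\<bar>" using False by (simp add: unit_cube_measure)
  finally show ?thesis .
qed

text \<open>A translation by \<open>v\<close> changes the uniform law on the cube by at most the \<open>l\<^sup>1\<close>-norm of \<open>v\<close> in total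
variation: only the points that leave the cube matter, and they lie in one slab per coordinate.\<close>

lemma unit_cube_translate:
  fixes H :: "real^'d::finite \<Rightarrow> ennreal"
  assumes [measurable]: "H \<in> borel_measurable borel" and H1: "\<And>u. H u \<le> 1"
  shows "(\<integral>\<^sup>+u. H u * indicator unit_cube u \<partial>lborel)
    \<le> (\<integral>\<^sup>+u. H (u + v) * indicator unit_cube u \<partial>lborel) + ennreal (\<Sum>j\<in>UNIV. \<bar>v $ j\<bar>)"
proof -
  define S where "S j = {u \<in> unit_cube. \<not> (0 \<le> u $ j + (- v $ j) \<and> u $ j + (- v $ j) < 1)}" for j
  have [measurable]: "S j \<in> sets borel" for j unfolding S_def by measurable
  have "(\<integral>\<^sup>+u. H u * indicator unit_cube u \<partial>lborel)
     \<le> (\<integral>\<^sup>+u. H u * indicator unit_cube (u - v) + (\<Sum>j\<in>UNIV. indicator (S j) u) \<partial>lborel)"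
  proof (rule nn_integral_mono)
    fix u :: "real^'d"
    show "H u * indicator unit_cube u \<le> H u * indicator unit_cube (u - v) + (\<Sum>j\<in>UNIV. indicator (S j) u)"
    proof (cases "u \<in> unit_cube \<and> u - v \<notin> unit_cube")
      case True
      then obtain j where "u \<in> S j" by (auto simp: S_def unit_cube_def)
      then have "(1::ennreal) \<le> (\<Sum>j\<in>UNIV. indicator (S j) u)"
        using member_le_sum[of j UNIV "\<lambda>j. indicator (S j) u :: ennreal"] by simp
      then show ?thesis using H1[of u] True by (auto intro: order_trans)
    qed (auto simp: indicator_def)
  qed
  also have "\<dots> = (\<integral>\<^sup>+u. H u * indicator unit_cube (u - v) \<partial>lborel) + (\<Sum>j\<in>UNIV. emeasure lborel (S j))"
    by (subst nn_integral_add) (simp_all add: nn_integral_sum)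
  also have "(\<integral>\<^sup>+u. H u * indicator unit_cube (u - v) \<partial>lborel) = (\<integral>\<^sup>+u. H (u + v) * indicator unit_cube u \<partial>lborel)"
    using nn_integral_lborel_translate[of "\<lambda>u. H u * indicator unit_cube (u - v)" v] by simp
  also have "(\<Sum>j\<in>UNIV. emeasure lborel (S j)) \<le> (\<Sum>j\<in>UNIV. ennreal \<bar>v $ j\<bar>)"
    unfolding S_def by (intro sum_mono order_trans[OF unit_cube_slab]) simp
  also have "\<dots> = ennreal (\<Sum>j\<in>UNIV. \<bar>v $ j\<bar>)" by (simp add: sum_ennreal)
  finally show ?thesis by (simp add: add_left_mono)
qed

section \<open>Inverse branches and cylinders\<close>

locale bernoulli =
  fixes M :: nat
    and E :: "nat \<Rightarrow> (real^'d::finite) set"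
    and D :: "nat \<Rightarrow> real^'d^'d"
    and e :: "nat \<Rightarrow> real^'d"
  assumes data: "bernoulli_data M E D e"
begin

text \<open>Everything is expressed through the inverse branches, because they turn the uniform law on the unit
cube into uniform laws on cylinders. The map \<open>word_map s\<close> is the composition of the inverse branches
along the word \<open>s\<close>. It is a similarity with ratio \<open>word_side s\<close> and orthogonal part \<open>word_rot s\<close>, and the
image of the unit cube under it is the cylinder of \<open>s\<close>.\<close>

definition side :: "nat \<Rightarrow> real" where
  "side i = measure lborel (E i) powr (1 / real CARD('d))"

definition inv_branch :: "nat \<Rightarrow> real^'d \<Rightarrow> real^'d" where
  "inv_branch i u = side i *\<^sub>R (transpose (D i) *v (u - e i))"

primrec word_map :: "nat list \<Rightarrow> real^'d \<Rightarrow> real^'d" where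
  "word_map [] u = u"
| "word_map (i # s) u = inv_branch i (word_map s u)"

primrec word_rot :: "nat list \<Rightarrow> real^'d \<Rightarrow> real^'d" where
  "word_rot [] v = v"
| "word_rot (i # s) v = transpose (D i) *v word_rot s v"

primrec word_side :: "nat list \<Rightarrow> real" where
  "word_side [] = 1"
| "word_side (i # s) = side i * word_side s"

abbreviation "\<phi> \<equiv> bernoulli_map M E D e"

lemma
  assumes "i \<in> {1..M}"
  shows orthogonal_D: "orthogonal_matrix (D i)"
    and bij_branch: "bij_betw (branch_affine E D e i) (E i) unit_cube"
    and measure_E: "0 < measure lborel (E i)" "measure lborel (E i) < 1"
    and E_subset: "E i \<subseteq> unit_cube"
  using data assms by (auto simp: bernoulli_data_def)

lemma ex_E: "y \<in> unit_cube \<Longrightarrow> \<exists>i\<in>{1..M}. y \<in> E i"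
  using data unfolding bernoulli_data_def by blast

lemma E_unique: "i \<in> {1..M} \<Longrightarrow> k \<in> {1..M} \<Longrightarrow> y \<in> E i \<Longrightarrow> y \<in> E k \<Longrightarrow> i = k"
  using data unfolding bernoulli_data_def disjoint_family_on_def by blast

lemma side_pos: "i \<in> {1..M} \<Longrightarrow> 0 < side i"
  using measure_E(1)[of i] by (simp add: side_def)

lemma side_less_1: "i \<in> {1..M} \<Longrightarrow> side i < 1"
  using measure_E[of i] unfolding side_def by (simp add: powr01_less_one)

lemma side_power: "i \<in> {1..M} \<Longrightarrow> side i ^ CARD('d) = measure lborel (E i)"
  using measure_E(1)[of i] by (simp add: side_def powr_realpow[symmetric] powr_powr)

lemma side_bounds:
  obtains \<rho> \<kappa> where "0 < \<rho>" "\<kappa> < 1" "0 < \<kappa>" "\<rho> \<le> 1" "\<And>i. i \<in> {1..M} \<Longrightarrow> \<rho> \<le> side i \<and> side i \<le> \<kappa>"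
proof
  have ne: "{1..M} \<noteq> {}" using data by (auto simp: bernoulli_data_def)
  have fin: "finite (side ` {1..M})" "side ` {1..M} \<noteq> {}" using ne by auto
  show "0 < Min (side ` {1..M})" using Min_in[OF fin] side_pos by auto
  show "Max (side ` {1..M}) < 1" using Max_in[OF fin] side_less_1 by auto
  show "0 < Max (side ` {1..M})" using Max_in[OF fin] side_pos by auto
  show "Min (side ` {1..M}) \<le> 1" using Min_in[OF fin] side_less_1 by fastforce
  show "Min (side ` {1..M}) \<le> side i \<and> side i \<le> Max (side ` {1..M})" if "i \<in> {1..M}" for i
    using that by auto
qed

lemma scale_side: "i \<in> {1..M} \<Longrightarrow> measure lborel (E i) powr (- 1 / real CARD('d)) * side i = 1"
  using measure_E(1)[of i] by (simp add: side_def powr_add[symmetric])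

lemma branch_inv_branch:
  assumes "i \<in> {1..M}"
  shows "branch_affine E D e i (inv_branch i u) = u"
proof -
  have "D i *v (transpose (D i) *v (u - e i)) = u - e i"
    using orthogonal_D[OF assms] by (simp add: matrix_vector_mul_assoc orthogonal_matrix_def del: transpose_matrix_vector)
  then show ?thesis
    using scale_side[OF assms]
    by (simp add: branch_affine_def inv_branch_def matrix_vector_mult_scaleR del: transpose_matrix_vector)
qed

lemma inv_branch_branch:
  assumes "i \<in> {1..M}"
  shows "inv_branch i (branch_affine E D e i x) = x"
proof -
  have "transpose (D i) *v (D i *v x) = x"
    using orthogonal_D[OF assms] by (simp add: matrix_vector_mul_assoc orthogonal_matrix_def del: transpose_matrix_vector)
  then show ?thesis
    using scale_side[OF assms]
    by (simp add: branch_affine_def inv_branch_def matrix_vector_mult_scaleR mult.commute del: transpose_matrix_vector)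
qed

lemma inv_branch_in: "i \<in> {1..M} \<Longrightarrow> u \<in> unit_cube \<Longrightarrow> inv_branch i u \<in> E i"
  using bij_branch[of i] inv_branch_branch[of i]
  unfolding bij_betw_def by (metis imageE)

lemma inv_branch_in_iff: "i \<in> {1..M} \<Longrightarrow> inv_branch i u \<in> E i \<longleftrightarrow> u \<in> unit_cube"
  by (metis inv_branch_in bij_betwE bij_branch branch_inv_branch)

lemma ex_inv_branch:
  assumes "y \<in> unit_cube"
  obtains i u where "i \<in> {1..M}" "u \<in> unit_cube" "y = inv_branch i u" "y \<in> E i"
proof -
  obtain i where "i \<in> {1..M}" "y \<in> E i" using ex_E[OF assms] by blast
  then show ?thesis
    using that[of i "branch_affine E D e i y"] bij_branch[of i] inv_branch_branch[of i y]
    by (metis bij_betwE)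
qed

lemma bernoulli_map_proj:
  assumes i: "i \<in> {1..M}" and y: "y \<in> E i"
  shows "\<phi> (proj y) = proj (branch_affine E D e i y)"
proof -
  have y': "y \<in> unit_cube" using E_subset[OF i] y by auto
  have "(THE i. i \<in> {1..M} \<and> proj y \<in> proj ` E i) = i"
  proof (rule the_equality)
    fix k assume k: "k \<in> {1..M} \<and> proj y \<in> proj ` E k"
    then obtain z where "z \<in> E k" "proj y = proj z" by auto
    then have "y \<in> E k" using proj_inj_on_unit_cube[of y z] y' E_subset[of k] k by auto
    then show "k = i" using E_unique[of k i y] y i k by blast
  qed (use i y in auto)
  then show ?thesis by (simp add: bernoulli_map_def branch_def check_proj[OF y'])
qed

lemma bernoulli_map_inv_branch:
  "i \<in> {1..M} \<Longrightarrow> u \<in> unit_cube \<Longrightarrow> \<phi> (proj (inv_branch i u)) = proj u"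
  by (simp add: bernoulli_map_proj[OF _ inv_branch_in] branch_inv_branch)

lemma measurable_matrix_vector_mult [measurable]: "(\<lambda>x. (A::real^'d^'d) *v x) \<in> borel_measurable borel"
  by (intro borel_measurable_continuous_onI matrix_vector_mult_linear_continuous_on)

lemma measurable_inv_branch [measurable]: "inv_branch i \<in> borel_measurable borel"
  unfolding inv_branch_def[abs_def] by measurable

lemma measurable_branch_affine [measurable]: "branch_affine E D e i \<in> borel_measurable borel"
  unfolding branch_affine_def[abs_def] by measurable

lemma E_eq: "i \<in> {1..M} \<Longrightarrow> E i = branch_affine E D e i -` unit_cube"
  by (intro set_eqI) (metis inv_branch_in_iff inv_branch_branch vimage_eq)

lemma sets_E [measurable]: "i \<in> {1..M} \<Longrightarrow> E i \<in> sets borel"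
  using measurable_sets_borel[OF measurable_branch_affine sets_unit_cube] by (simp add: E_eq)

text \<open>The map is a gluing of finitely many Borel maps along the Borel pieces \<open>E i\<close>.\<close>

lemma measurable_bernoulli_map [measurable]: "\<phi> \<in> borel_measurable borel"
proof -
  have "\<phi> x = proj (branch_affine E D e i (check x))" if "i \<in> {1..M}" "check x \<in> E i" for x i
    using bernoulli_map_proj[OF that] by (simp add: check_props)
  then have "\<phi> -` A = (\<Union>i\<in>{1..M}. {x. check x \<in> E i} \<inter> {x. proj (branch_affine E D e i (check x)) \<in> A})" for A
    using ex_E[OF check_props(1)] by (intro set_eqI) (simp add: Bex_def, metis)
  moreover have "(\<Union>i\<in>{1..M}. {x. check x \<in> E i} \<inter> {x. proj (branch_affine E D e i (check x)) \<in> A}) \<in> sets borel"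
    if A: "A \<in> sets borel" for A
  proof (intro sets.finite_UN finite_atLeastAtMost sets.Int)
    fix i assume "i \<in> {1..M}"
    then show "{x. check x \<in> E i} \<in> sets borel"
      using measurable_sets_borel[OF measurable_check sets_E] by (simp add: vimage_def)
    have "(\<lambda>x. proj (branch_affine E D e i (check x))) \<in> borel_measurable borel" by measurable
    from measurable_sets_borel[OF this A]
    show "{x. proj (branch_affine E D e i (check x)) \<in> A} \<in> sets borel" by (simp add: vimage_def)
  qed
  ultimately show ?thesis by (intro measurableI) auto
qed

lemma word_side_pos: "set s \<subseteq> {1..M} \<Longrightarrow> 0 < word_side s"
  by (induction s) (auto simp: side_pos)

lemma measurable_word_map [measurable]: "word_map s \<in> borel_measurable borel"
  by (induction s) (simp_all, measurable)

lemma word_rot_orthogonal: "set s \<subseteq> {1..M} \<Longrightarrow> orthogonal_transformation (word_rot s)"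
proof (induction s)
  case (Cons i s)
  then have "orthogonal_matrix (transpose (D i))" using orthogonal_D by simp
  then have "orthogonal_transformation ((*v) (transpose (D i)))"
    by (simp add: orthogonal_transformation_matrix del: transpose_matrix_vector)
  from orthogonal_transformation_compose[OF this] Cons show ?case
    by (simp add: o_def del: transpose_matrix_vector)
qed (simp add: orthogonal_transformation_def linear_iff)

lemma word_map_add: "word_map s (u + v) = word_map s u + word_side s *\<^sub>R word_rot s v"
proof (induction s arbitrary: u v)
  case (Cons i s)
  have *: "word_map s (u + v) - e i = (word_map s u - e i) + word_side s *\<^sub>R word_rot s v"
    by (simp add: Cons)
  show ?case
    unfolding word_map.simps inv_branch_def *
    by (simp add: matrix_vector_mult_scaleR matrix_vector_right_distrib scaleR_add_right
        del: transpose_matrix_vector add_diff_eq diff_add_eq)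
qed simp

lemma word_map_in: "set s \<subseteq> {1..M} \<Longrightarrow> u \<in> unit_cube \<Longrightarrow> word_map s u \<in> unit_cube"
  by (induction s) (use inv_branch_in E_subset in auto)

text \<open>The map shifts words: it sends the uniform law on the cylinder of \<open>i # s\<close> exactly to the uniform law on
the cylinder of \<open>s\<close>, whose side is longer by the factor \<open>1 / side i\<close>.\<close>

lemma bernoulli_map_word:
  "set (i # s) \<subseteq> {1..M} \<Longrightarrow> u \<in> unit_cube \<Longrightarrow> \<phi> (proj (word_map (i # s) u)) = proj (word_map s u)"
  using bernoulli_map_inv_branch word_map_in by auto

text \<open>Refining the cylinder around \<open>y\<close> shrinks its side by a factor in \<open>[\<rho>, \<kappa>]\<close> per letter, so some cylinder
around \<open>y\<close> has a side comparable to any prescribed \<open>r\<close>. The induction reads words from the front: after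
the first letter \<open>i\<close> the problem repeats inside the unit cube with \<open>r\<close> replaced by \<open>r / side i\<close>, unless
the single letter is already short enough.\<close>

lemma ex_cylinder:
  assumes b: "0 < \<rho>" "\<rho> \<le> 1" "0 < \<kappa>" "\<kappa> < 1" "\<And>i. i \<in> {1..M} \<Longrightarrow> \<rho> \<le> side i \<and> side i \<le> \<kappa>"
    and "\<kappa> ^ n \<le> r" "r \<le> 1" "y \<in> unit_cube"
  shows "\<exists>s u. set s \<subseteq> {1..M} \<and> length s \<le> n \<and> u \<in> unit_cube \<and> y = word_map s u \<and>
    \<rho> * r \<le> word_side s \<and> word_side s \<le> r"
  using assms(6-)
proof (induction n arbitrary: r y)
  case 0
  then show ?case using b by (intro exI[of _ "[]"] exI[of _ y]) auto
next
  case (Suc n)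
  obtain i u where i: "i \<in> {1..M}" "u \<in> unit_cube" "y = inv_branch i u"
    using ex_inv_branch[OF Suc.prems(3)] by metis
  show ?case
  proof (cases "side i \<le> r")
    case True
    have "\<rho> * r \<le> \<rho> * 1" using b Suc.prems(2) by (intro mult_left_mono) auto
    then show ?thesis
      using i True b(5)[of i] by (intro exI[of _ "[i]"] exI[of _ u]) auto
  next
    case False
    have pos: "0 < side i" by (rule side_pos[OF i(1)])
    have "\<kappa> ^ n * side i \<le> \<kappa> ^ n * \<kappa>" using b(3) b(5)[OF i(1)] by (intro mult_left_mono) auto
    also have "\<dots> \<le> r" using Suc.prems(1) by (simp add: mult.commute)
    finally have "\<kappa> ^ n \<le> r / side i" using pos by (simp add: field_simps)
    moreover have "r / side i \<le> 1" using False pos by (simp add: field_simps)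
    ultimately obtain s u' where s: "set s \<subseteq> {1..M}" "length s \<le> n" "u' \<in> unit_cube" "u = word_map s u'"
      "\<rho> * (r / side i) \<le> word_side s" "word_side s \<le> r / side i"
      using Suc.IH[of "r / side i" u] i(2) by blast
    then show ?thesis
      using i pos by (intro exI[of _ "i # s"] exI[of _ u']) (auto simp: field_simps)
  qed
qed

end

section \<open>One noisy step applied to uniform laws on cylinders\<close>

text \<open>The Markov operator of the chain \<open>x \<mapsto> f x + z\<close>, acting on observables.\<close>

definition transition :: "('d::finite torus \<Rightarrow> 'd torus) \<Rightarrow> 'd torus measure \<Rightarrow> ('d torus \<Rightarrow> ennreal) \<Rightarrow> 'd torus \<Rightarrow> ennreal" where
  "transition f Q h x = (\<integral>\<^sup>+z. h (f x + z) \<partial>Q)"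

lemma measurable_transition:
  assumes [measurable]: "f \<in> borel_measurable borel" "h \<in> borel_measurable borel"
    and "sigma_finite_measure Q" and [measurable_cong]: "sets Q = sets borel"
  shows "transition f Q h \<in> borel_measurable borel"
proof -
  interpret sigma_finite_measure Q by fact
  show ?thesis unfolding transition_def[abs_def] by measurable
qed

text \<open>These are the properties of the noise that the mixing bound depends on, shared by the Gaussian and by
the separated densities: a lower bound on every ball, which starts the chain on a cylinder of side
comparable to \<open>\<epsilon>\<close>, and a first moment, which bounds the damage that the noise does to the uniform law on
a larger cylinder.\<close>

definition regular_density :: "(real^'d::finite \<Rightarrow> real) \<Rightarrow> bool" where
  "regular_density K \<longleftrightarrow> prob_density K \<and> (\<forall>R. \<exists>c>0. \<forall>x. norm x \<le> R \<longrightarrow> c \<le> K x) \<and>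
     (\<integral>\<^sup>+x. ennreal (norm x * K x) \<partial>lborel) < \<infinity>"

lemma sum_abs_le_norm: "(\<Sum>j\<in>UNIV. \<bar>v $ j\<bar>) \<le> real CARD('d) * norm (v :: real^'d::finite)"
  using sum_bounded_above[of UNIV "\<lambda>j. \<bar>v $ j\<bar>" "norm v"] component_le_norm_cart[of v] by auto

lemma norm_diff_unit_cube:
  fixes u v :: "real^'d::finite"
  assumes "u \<in> unit_cube" "v \<in> unit_cube"
  shows "norm (u - v) \<le> real CARD('d)"
proof -
  have "\<bar>(u - v) $ j\<bar> \<le> 1" for j
    using assms by (auto simp: unit_cube_def abs_le_iff) (smt (verit, best))+
  then have "(\<Sum>j\<in>UNIV. \<bar>(u - v) $ j\<bar>) \<le> real CARD('d)"
    using sum_bounded_above[of UNIV "\<lambda>j. \<bar>(u - v) $ j\<bar>" 1] by auto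
  then show ?thesis using norm_le_l1_cart[of "u - v"] by linarith
qed

locale noisy_bernoulli = bernoulli M E D e
  for M and E :: "nat \<Rightarrow> (real^'d::finite) set" and D e +
  fixes K :: "real^'d \<Rightarrow> real" and \<epsilon> :: real
  assumes regular: "regular_density K" and eps: "0 < \<epsilon>"
begin

abbreviation "Q \<equiv> noise_law K \<epsilon>"
abbreviation "L \<equiv> transition \<phi> Q"

lemma measurable_K [measurable]: "K \<in> borel_measurable borel"
  and K_nonneg: "0 \<le> K x"
  and K_mass: "(\<integral>\<^sup>+x. ennreal (K x) \<partial>lborel) = 1"
  using regular by (auto simp: regular_density_def prob_density_def)

lemma prob_space_Q: "prob_space Q"
  and sets_Q [measurable_cong, simp]: "sets Q = sets borel"
proof -
  have "prob_space (density lborel K)"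
    using K_mass by (intro prob_spaceI) (simp add: emeasure_density)
  then show "prob_space Q"
    by (subst noise_law_eq_distr[OF measurable_K K_nonneg eps])
       (auto intro!: prob_space.prob_space_distr simp: K_nonneg)
  show "sets Q = sets borel" by (simp add: noise_law_def)
qed

lemma transition_eq:
  assumes [measurable]: "h \<in> borel_measurable borel"
  shows "L h x = (\<integral>\<^sup>+w. ennreal (K w) * h (\<phi> x + proj (\<epsilon> *\<^sub>R w)) \<partial>lborel)"
  unfolding transition_def noise_law_eq_distr[OF measurable_K K_nonneg eps]
  by (subst nn_integral_distr, measurable, subst nn_integral_density) simp_all

lemma measurable_L [measurable]: "h \<in> borel_measurable borel \<Longrightarrow> L h \<in> borel_measurable borel"
  by (rule measurable_transition[OF measurable_bernoulli_map _ prob_space_imp_sigma_finite[OF prob_space_Q] sets_Q])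

lemma L_le_1: "(\<And>x. h x \<le> 1) \<Longrightarrow> L h x \<le> 1"
  unfolding transition_def
  using nn_integral_mono[of Q "\<lambda>z. h (\<phi> x + z)" "\<lambda>_. 1"] prob_space.emeasure_space_1[OF prob_space_Q]
  by simp

lemma L_pow_props:
  assumes "h \<in> borel_measurable borel" "\<And>x. h x \<le> 1"
  shows "(L ^^ n) h \<in> borel_measurable borel" "(L ^^ n) h x \<le> 1"
proof (induction n arbitrary: x)
  case (Suc n)
  { case 1 then show ?case using Suc measurable_L by simp }
  { case 2 then show ?case using Suc L_le_1[of "(L ^^ n) h"] by simp }
qed (use assms in simp_all)

text \<open>The average of \<open>h\<close> against the uniform law on the cylinder of \<open>s\<close>, parametrized by the unit cube.\<close>

definition cyl_avg :: "nat list \<Rightarrow> ('d torus \<Rightarrow> ennreal) \<Rightarrow> ennreal" where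
  "cyl_avg s h = (\<integral>\<^sup>+u. h (proj (word_map s u)) * indicator unit_cube u \<partial>lborel)"

lemma cyl_avg_Nil: "h \<in> borel_measurable borel \<Longrightarrow> cyl_avg [] h = (\<integral>\<^sup>+x. h x \<partial>torus_measure)"
  by (simp add: cyl_avg_def nn_integral_torus)

text \<open>The deterministic part of the step only shortens the word; what remains is the noise, added to a
uniform point of the larger cylinder.\<close>

lemma cyl_avg_L:
  assumes s: "set (i # s) \<subseteq> {1..M}" and [measurable]: "h \<in> borel_measurable borel"
  shows "cyl_avg (i # s) (L h) =
    (\<integral>\<^sup>+w. ennreal (K w) * (\<integral>\<^sup>+u. h (proj (word_map s u + \<epsilon> *\<^sub>R w)) * indicator unit_cube u \<partial>lborel) \<partial>lborel)"
proof -
  have "cyl_avg (i # s) (L h) = (\<integral>\<^sup>+u. (\<integral>\<^sup>+w. ennreal (K w) * (h (proj (word_map s u + \<epsilon> *\<^sub>R w)) * indicator unit_cube u) \<partial>lborel) \<partial>lborel)"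
    unfolding cyl_avg_def
  proof (rule nn_integral_cong)
    fix u :: "real^'d"
    show "L h (proj (word_map (i # s) u)) * indicator unit_cube u =
       (\<integral>\<^sup>+w. ennreal (K w) * (h (proj (word_map s u + \<epsilon> *\<^sub>R w)) * indicator unit_cube u) \<partial>lborel)"
      by (cases "u \<in> unit_cube")
         (simp_all add: transition_eq bernoulli_map_word[OF s] proj_add del: word_map.simps)
  qed
  also have "\<dots> = (\<integral>\<^sup>+w. (\<integral>\<^sup>+u. ennreal (K w) * (h (proj (word_map s u + \<epsilon> *\<^sub>R w)) * indicator unit_cube u) \<partial>lborel) \<partial>lborel)"
    by (rule lborel_pair.Fubini'[symmetric]) measurable
  also have "\<dots> = (\<integral>\<^sup>+w. ennreal (K w) * (\<integral>\<^sup>+u. h (proj (word_map s u + \<epsilon> *\<^sub>R w)) * indicator unit_cube u \<partial>lborel) \<partial>lborel)"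
    by (simp add: nn_integral_cmult)
  finally show ?thesis .
qed

text \<open>A bound for the mean \<open>l\<^sup>1\<close>-norm of a vector with density \<open>K\<close>; \<open>enn2real\<close> loses nothing because the first
moment is finite.\<close>

definition noise_size :: real where
  "noise_size = real CARD('d) * enn2real (\<integral>\<^sup>+w. ennreal (norm w * K w) \<partial>lborel)"

lemma noise_size_nonneg: "0 \<le> noise_size"
  by (simp add: noise_size_def)

text \<open>Measured in units of the cylinder of \<open>s\<close>, the noise \<open>\<epsilon> w\<close> is a translation of the unit cube by a vector of
length \<open>\<epsilon> / word_side s\<close> times \<open>norm w\<close>, which changes the uniform law by at most the \<open>l\<^sup>1\<close>-norm of
that vector. Averaging over \<open>w\<close> gives the error term.\<close>

lemma cyl_avg_step:
  assumes s: "set (i # s) \<subseteq> {1..M}" and [measurable]: "h \<in> borel_measurable borel" and h1: "\<And>x. h x \<le> 1"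
  shows "cyl_avg s h \<le> cyl_avg (i # s) (L h) + ennreal (noise_size * \<epsilon> / word_side s)"
proof -
  let ?r = "word_side s"
  have s': "set s \<subseteq> {1..M}" and r: "0 < ?r" using s word_side_pos[of s] by auto
  have O: "orthogonal_transformation (word_rot s)" by (rule word_rot_orthogonal[OF s'])
  have lin: "linear (word_rot s)" using O by (rule orthogonal_transformation_linear)
  obtain S where S: "\<And>y. word_rot s (S y) = y"
    using orthogonal_transformation_surj[OF O] by (metis surj_def)
  have norm_S: "norm (S y) = norm y" for y
    using orthogonal_transformation_norm[OF O, of "S y"] S by simp
  let ?J = "\<lambda>w. \<integral>\<^sup>+u. h (proj (word_map s u + \<epsilon> *\<^sub>R w)) * indicator unit_cube u \<partial>lborel"
  have pt: "cyl_avg s h \<le> ?J w + ennreal (real CARD('d) * norm w * (\<epsilon> / ?r))" for w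
  proof -
    \<comment> \<open>The vector with \<open>word_map s (u + v) = word_map s u + \<epsilon> w\<close>.\<close>
    define v where "v = (\<epsilon> / ?r) *\<^sub>R S w"
    have eq: "word_map s u + \<epsilon> *\<^sub>R w = word_map s (u + v)" for u
      using r by (simp add: word_map_add v_def linear_scale[OF lin] S)
    have "cyl_avg s h \<le> ?J w + ennreal (\<Sum>j\<in>UNIV. \<bar>v $ j\<bar>)"
      unfolding eq cyl_avg_def by (rule unit_cube_translate) (use h1 in auto)
    also have "(\<Sum>j\<in>UNIV. \<bar>v $ j\<bar>) \<le> real CARD('d) * norm v" by (rule sum_abs_le_norm)
    also have "\<dots> = real CARD('d) * norm w * (\<epsilon> / ?r)"
      using eps r by (simp add: v_def norm_S)
    finally show ?thesis by (simp add: add_left_mono ennreal_leI)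
  qed
  have "cyl_avg s h = (\<integral>\<^sup>+w. ennreal (K w) * cyl_avg s h \<partial>lborel)"
    by (simp add: nn_integral_multc K_mass)
  also have "\<dots> \<le> (\<integral>\<^sup>+w. ennreal (K w) * (?J w + ennreal (real CARD('d) * norm w * (\<epsilon> / ?r))) \<partial>lborel)"
    by (intro nn_integral_mono mult_left_mono pt) simp
  also have "\<dots> = (\<integral>\<^sup>+w. ennreal (K w) * ?J w + ennreal (real CARD('d) * (\<epsilon> / ?r)) * ennreal (norm w * K w) \<partial>lborel)"
  proof (rule nn_integral_cong)
    fix w
    have "ennreal (K w) * ennreal (real CARD('d) * norm w * (\<epsilon> / ?r)) = ennreal (real CARD('d) * (\<epsilon> / ?r)) * ennreal (norm w * K w)"
      using eps r K_nonneg[of w] by (simp add: ennreal_mult[symmetric] ac_simps)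
    then show "ennreal (K w) * (?J w + ennreal (real CARD('d) * norm w * (\<epsilon> / ?r)))
      = ennreal (K w) * ?J w + ennreal (real CARD('d) * (\<epsilon> / ?r)) * ennreal (norm w * K w)"
      by (simp only: distrib_left)
  qed
  also have "\<dots> = cyl_avg (i # s) (L h) + ennreal (real CARD('d) * (\<epsilon> / ?r)) * (\<integral>\<^sup>+w. ennreal (norm w * K w) \<partial>lborel)"
    by (subst nn_integral_add) (simp_all add: cyl_avg_L[OF s] nn_integral_cmult)
  also have "(\<integral>\<^sup>+w. ennreal (norm w * K w) \<partial>lborel) = ennreal (enn2real (\<integral>\<^sup>+w. ennreal (norm w * K w) \<partial>lborel))"
    using regular by (simp add: regular_density_def)
  also have "ennreal (real CARD('d) * (\<epsilon> / ?r)) * \<dots> = ennreal (noise_size * \<epsilon> / ?r)"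
    using eps r by (simp add: ennreal_mult[symmetric] noise_size_def ac_simps)
  finally show ?thesis .
qed

text \<open>The branch on \<open>E i\<close> pushes the restriction of Lebesgue measure to \<open>E i\<close> to the uniform law times the
measure of \<open>E i\<close>, and these measures add up to 1.\<close>

lemma nn_integral_bernoulli_map:
  assumes [measurable]: "g \<in> borel_measurable borel"
  shows "(\<integral>\<^sup>+x. g (\<phi> x) \<partial>torus_measure) = (\<integral>\<^sup>+x. g x \<partial>torus_measure)"
proof -
  have branch: "(\<integral>\<^sup>+u. g (\<phi> (proj u)) * indicator (E i) u \<partial>lborel)
      = emeasure lborel (E i) * (\<integral>\<^sup>+x. g x \<partial>torus_measure)" if i: "i \<in> {1..M}" for i
  proof -
    have [measurable]: "E i \<in> sets borel" by (rule sets_E[OF i])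
    have i': "set [i] \<subseteq> {1..M}" using i by simp
    have eq: "inv_branch i u = side i *\<^sub>R word_rot [i] (u - e i)" for u
      by (simp add: inv_branch_def)
    have "emeasure lborel (E i) \<le> emeasure lborel (unit_cube :: (real^'d) set)"
      by (rule emeasure_mono[OF E_subset[OF i]]) simp
    then have fin: "emeasure lborel (E i) \<noteq> \<infinity>" by (auto simp: unit_cube_measure top_unique)
    have "(\<integral>\<^sup>+u. g (\<phi> (proj u)) * indicator (E i) u \<partial>lborel)
      = ennreal (side i ^ CARD('d)) * (\<integral>\<^sup>+u. g (\<phi> (proj (inv_branch i u))) * indicator (E i) (inv_branch i u) \<partial>lborel)"
      unfolding eq by (rule nn_integral_similarity[OF word_rot_orthogonal[OF i'] _ side_pos[OF i]]) measurable
    also have "(\<integral>\<^sup>+u. g (\<phi> (proj (inv_branch i u))) * indicator (E i) (inv_branch i u) \<partial>lborel)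
      = (\<integral>\<^sup>+u. g (proj u) * indicator unit_cube u \<partial>lborel)"
      by (intro nn_integral_cong) (auto simp: indicator_def inv_branch_in_iff[OF i] bernoulli_map_inv_branch[OF i])
    also have "\<dots> = (\<integral>\<^sup>+x. g x \<partial>torus_measure)" by (simp add: nn_integral_torus)
    also have "ennreal (side i ^ CARD('d)) = emeasure lborel (E i)"
      using fin by (simp add: side_power[OF i] emeasure_eq_ennreal_measure)
    finally show ?thesis .
  qed
  have dis: "disjoint_family_on E {1..M}" and un: "(\<Union>i\<in>{1..M}. E i) = unit_cube"
    using data by (auto simp: bernoulli_data_def)
  have ind: "indicator unit_cube u = (\<Sum>i\<in>{1..M}. indicator (E i) u :: ennreal)" for u
    unfolding un[symmetric] by (rule indicator_UN_disjoint[OF _ dis]) simp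
  have "(\<integral>\<^sup>+x. g (\<phi> x) \<partial>torus_measure) = (\<integral>\<^sup>+u. (\<Sum>i\<in>{1..M}. g (\<phi> (proj u)) * indicator (E i) u) \<partial>lborel)"
    by (simp add: nn_integral_torus ind sum_distrib_left)
  also have "\<dots> = (\<Sum>i\<in>{1..M}. \<integral>\<^sup>+u. g (\<phi> (proj u)) * indicator (E i) u \<partial>lborel)"
    by (rule nn_integral_sum) (use sets_E in measurable)
  also have "\<dots> = (\<Sum>i\<in>{1..M}. emeasure lborel (E i)) * (\<integral>\<^sup>+x. g x \<partial>torus_measure)"
    by (simp add: branch sum_distrib_right)
  also have "(\<Sum>i\<in>{1..M}. emeasure lborel (E i)) = emeasure lborel (\<Union>i\<in>{1..M}. E i)"
    by (rule sum_emeasure[OF _ dis]) (use sets_E in auto)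
  also have "\<dots> = 1" by (simp only: un unit_cube_measure)
  finally show ?thesis by simp
qed

lemma torus_measure_stationary:
  assumes [measurable]: "h \<in> borel_measurable borel"
  shows "(\<integral>\<^sup>+x. L h x \<partial>torus_measure) = (\<integral>\<^sup>+x. h x \<partial>torus_measure)"
proof -
  interpret T: prob_space "torus_measure :: 'd torus measure" by (rule prob_space_torus_measure)
  interpret P: pair_sigma_finite "torus_measure :: 'd torus measure" "lborel :: (real^'d) measure" ..
  have "(\<integral>\<^sup>+x. L h x \<partial>torus_measure) = (\<integral>\<^sup>+x. (\<integral>\<^sup>+w. ennreal (K w) * h (\<phi> x + proj (\<epsilon> *\<^sub>R w)) \<partial>lborel) \<partial>torus_measure)"
    by (simp add: transition_eq)
  also have "\<dots> = (\<integral>\<^sup>+w. (\<integral>\<^sup>+x. ennreal (K w) * h (\<phi> x + proj (\<epsilon> *\<^sub>R w)) \<partial>torus_measure) \<partial>lborel)"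
    by (rule P.Fubini'[symmetric]) measurable
  also have "\<dots> = (\<integral>\<^sup>+w. ennreal (K w) * (\<integral>\<^sup>+x. h x \<partial>torus_measure) \<partial>lborel)"
  proof (rule nn_integral_cong)
    fix w
    have "(\<integral>\<^sup>+x. h (\<phi> x + proj (\<epsilon> *\<^sub>R w)) \<partial>torus_measure) = (\<integral>\<^sup>+x. h x \<partial>torus_measure)"
      using nn_integral_bernoulli_map[of "\<lambda>x. h (x + proj (\<epsilon> *\<^sub>R w))"] nn_integral_torus_translate[of h] by simp
    then show "(\<integral>\<^sup>+x. ennreal (K w) * h (\<phi> x + proj (\<epsilon> *\<^sub>R w)) \<partial>torus_measure) = ennreal (K w) * (\<integral>\<^sup>+x. h x \<partial>torus_measure)"
      by (subst nn_integral_cmult) simp_all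
  qed
  also have "\<dots> = (\<integral>\<^sup>+x. h x \<partial>torus_measure)" by (simp add: nn_integral_multc K_mass)
  finally show ?thesis .
qed

end

section \<open>Minorization after logarithmically many steps\<close>

context noisy_bernoulli begin

text \<open>A chain that starts with the uniform law on the cylinder of \<open>s\<close> has passed through all suffixes of \<open>s\<close>
after \<open>length s\<close> steps, up to the errors of \<open>cyl_avg_step\<close>. The sides of the suffixes grow at least
geometrically, so the errors are bounded by a geometric series, whose sum is of order \<open>\<epsilon> / word_side s\<close>. From then on the law stays at the stationary measure.\<close>

lemma cyl_avg_iterate:
  assumes \<kappa>: "0 < \<kappa>" "\<kappa> < 1" "\<And>i. i \<in> {1..M} \<Longrightarrow> side i \<le> \<kappa>"
    and h: "h \<in> borel_measurable borel" "\<And>x. h x \<le> 1"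
    and s: "set s \<subseteq> {1..M}" "length s \<le> n"
  shows "(\<integral>\<^sup>+x. h x \<partial>torus_measure) \<le> cyl_avg s ((L ^^ n) h) + ennreal (noise_size * \<epsilon> * \<kappa> / ((1 - \<kappa>) * word_side s))"
  using s
proof (induction s arbitrary: n)
  case Nil
  have "(\<integral>\<^sup>+x. (L ^^ n) h x \<partial>torus_measure) = (\<integral>\<^sup>+x. h x \<partial>torus_measure)"
    by (induction n) (simp_all add: torus_measure_stationary L_pow_props[OF h])
  then show ?case using L_pow_props(1)[OF h] by (simp add: cyl_avg_Nil)
next
  case (Cons i s)
  then obtain m where n: "n = Suc m" "length s \<le> m" by (cases n) auto
  have i: "i \<in> {1..M}" and s: "set s \<subseteq> {1..M}" using Cons.prems by auto
  have r: "0 < word_side s" and si: "0 < side i" using word_side_pos[OF s] side_pos[OF i] by auto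
  let ?e = "noise_size * \<epsilon> / word_side s"
  have e: "0 \<le> ?e" using noise_size_nonneg eps r by simp
  have "(\<integral>\<^sup>+x. h x \<partial>torus_measure) \<le> cyl_avg s ((L ^^ m) h) + ennreal (?e * (\<kappa> / (1 - \<kappa>)))"
    using Cons.IH[OF s n(2)] by (simp add: field_simps)
  also have "cyl_avg s ((L ^^ m) h) \<le> cyl_avg (i # s) (L ((L ^^ m) h)) + ennreal ?e"
    by (rule cyl_avg_step[OF Cons.prems(1) L_pow_props[OF h]])
  also have "cyl_avg (i # s) (L ((L ^^ m) h)) + ennreal ?e + ennreal (?e * (\<kappa> / (1 - \<kappa>)))
    = cyl_avg (i # s) ((L ^^ n) h) + ennreal (?e * (1 / (1 - \<kappa>)))"
  proof -
    have "?e + ?e * (\<kappa> / (1 - \<kappa>)) = ?e * (1 / (1 - \<kappa>))" using \<kappa> r by (simp add: field_simps)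
    moreover have "0 \<le> ?e * (\<kappa> / (1 - \<kappa>))" using e \<kappa>(1,2) by (intro mult_nonneg_nonneg) auto
    ultimately have "ennreal ?e + ennreal (?e * (\<kappa> / (1 - \<kappa>))) = ennreal (?e * (1 / (1 - \<kappa>)))"
      using e by (simp only: ennreal_plus[symmetric])
    then show ?thesis by (simp add: n add.assoc)
  qed
  also have "?e * (1 / (1 - \<kappa>)) \<le> ?e * (1 / (1 - \<kappa>)) * (\<kappa> / side i)"
  proof -
    have "1 \<le> \<kappa> / side i" using \<kappa>(3)[OF i] si by simp
    moreover have "0 \<le> ?e * (1 / (1 - \<kappa>))" using e \<kappa>(2) by (intro mult_nonneg_nonneg) auto
    ultimately show ?thesis using mult_left_mono[of 1 "\<kappa> / side i" "?e * (1 / (1 - \<kappa>))"] by simp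
  qed
  also have "?e * (1 / (1 - \<kappa>)) * (\<kappa> / side i) = noise_size * \<epsilon> * \<kappa> / ((1 - \<kappa>) * word_side (i # s))"
    by (simp add: field_simps)
  finally show ?case by (simp add: add_left_mono ennreal_leI)
qed

text \<open>One step of noise covers a cylinder. The cylinder around the image \<open>y\<close> of \<open>x\<close> with side at most \<open>A \<epsilon>\<close> lies
within distance \<open>A \<epsilon> CARD('d)\<close> of \<open>y\<close>, where the density of the noise is at least \<open>c \<epsilon>\<^sup>-\<^sup>d\<close>. Hence the
law after one step dominates a fixed multiple of the uniform law on that cylinder, with a factor that
depends on neither \<open>\<epsilon>\<close> nor \<open>x\<close>.\<close>

lemma L_ge_cyl_avg:
  assumes b: "0 < \<rho>" "\<rho> \<le> 1" "0 < \<kappa>" "\<kappa> < 1" "\<And>i. i \<in> {1..M} \<Longrightarrow> \<rho> \<le> side i \<and> side i \<le> \<kappa>"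
    and A: "0 < A" "\<kappa> ^ n \<le> A * \<epsilon>" "A * \<epsilon> \<le> 1"
    and c: "0 \<le> c" "\<And>w. norm w \<le> A * real CARD('d) \<Longrightarrow> c \<le> K w"
  obtains s where "set s \<subseteq> {1..M}" "length s \<le> n" "\<rho> * (A * \<epsilon>) \<le> word_side s"
    "\<And>h. h \<in> borel_measurable borel \<Longrightarrow> ennreal (c * (\<rho> * A) ^ CARD('d)) * cyl_avg s h \<le> L h x"
proof -
  define y where "y = check (\<phi> x)"
  have y: "y \<in> unit_cube" "proj y = \<phi> x" by (simp_all add: y_def check_props)
  obtain s u0 where s: "set s \<subseteq> {1..M}" "length s \<le> n" and u0: "u0 \<in> unit_cube" "y = word_map s u0"
    and size: "\<rho> * (A * \<epsilon>) \<le> word_side s" "word_side s \<le> A * \<epsilon>"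
    using ex_cylinder[OF b A(2,3) y(1)] by blast
  define r where "r = word_side s / \<epsilon>"
  have r: "0 < r" "\<rho> * A \<le> r" "r \<le> A"
    using size eps word_side_pos[OF s(1)] by (simp_all add: r_def field_simps)
  have O: "orthogonal_transformation (word_rot s)" by (rule word_rot_orthogonal[OF s(1)])
  have mapeq: "y + \<epsilon> *\<^sub>R (r *\<^sub>R word_rot s (u - u0)) = word_map s u" for u
    using word_map_add[of s u0 "u - u0"] eps by (simp add: u0(2) r_def)
  have "ennreal (c * (\<rho> * A) ^ CARD('d)) * cyl_avg s h \<le> L h x" if [measurable]: "h \<in> borel_measurable borel" for h
  proof -
    have "ennreal (c * (\<rho> * A) ^ CARD('d)) * cyl_avg s h \<le> ennreal (c * r ^ CARD('d)) * cyl_avg s h"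
      using c(1) r b(1) A(1) by (intro mult_right_mono ennreal_leI mult_left_mono power_mono) auto
    also have "\<dots> = ennreal (r ^ CARD('d)) * (\<integral>\<^sup>+u. ennreal c * (h (proj (word_map s u)) * indicator unit_cube u) \<partial>lborel)"
      using c(1) r(1) by (simp add: cyl_avg_def nn_integral_cmult ennreal_mult ac_simps)
    also have "\<dots> \<le> ennreal (r ^ CARD('d)) * (\<integral>\<^sup>+u. ennreal (K (r *\<^sub>R word_rot s (u - u0))) * h (proj (y + \<epsilon> *\<^sub>R (r *\<^sub>R word_rot s (u - u0)))) \<partial>lborel)"
    proof (intro mult_left_mono nn_integral_mono)
      fix u :: "real^'d"
      show "ennreal c * (h (proj (word_map s u)) * indicator unit_cube u)
        \<le> ennreal (K (r *\<^sub>R word_rot s (u - u0))) * h (proj (y + \<epsilon> *\<^sub>R (r *\<^sub>R word_rot s (u - u0))))"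
      proof (cases "u \<in> unit_cube")
        case True
        have "norm (r *\<^sub>R word_rot s (u - u0)) = r * norm (u - u0)"
          using r by (simp add: orthogonal_transformation_norm[OF O])
        also have "\<dots> \<le> A * real CARD('d)"
          using r norm_diff_unit_cube[OF True u0(1)] by (intro mult_mono) auto
        finally show ?thesis
          unfolding mapeq using True c(2) by (simp add: mult_right_mono ennreal_leI)
      qed simp
    qed simp
    also have "\<dots> = (\<integral>\<^sup>+w. ennreal (K w) * h (proj (y + \<epsilon> *\<^sub>R w)) \<partial>lborel)"
      by (rule nn_integral_similarity[OF O _ r(1), symmetric]) measurable
    also have "\<dots> = L h x" by (simp add: transition_eq y(2)[symmetric] proj_add)
    finally show ?thesis .
  qed
  then show ?thesis using that[OF s size(1)] by blast
qed

text \<open>The first step puts a fixed fraction \<open>a\<close> of the mass uniformly on a cylinder, and the remaining \<open>n\<close> steps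
carry this fraction to within \<open>1 / 4\<close> of the stationary measure, provided that \<open>A\<close> is large.\<close>

lemma doeblin:
  assumes b: "0 < \<rho>" "\<rho> \<le> 1" "0 < \<kappa>" "\<kappa> < 1" "\<And>i. i \<in> {1..M} \<Longrightarrow> \<rho> \<le> side i \<and> side i \<le> \<kappa>"
    and A: "0 < A" "\<kappa> ^ n \<le> A * \<epsilon>" "A * \<epsilon> \<le> 1" "noise_size * \<kappa> / ((1 - \<kappa>) * \<rho> * A) \<le> 1 / 4"
    and c: "0 \<le> c" "\<And>w. norm w \<le> A * real CARD('d) \<Longrightarrow> c \<le> K w"
    and h: "h \<in> borel_measurable borel" "\<And>x. h x \<le> 1"
  defines "a \<equiv> c * (\<rho> * A) ^ CARD('d)"
  shows "ennreal a * (\<integral>\<^sup>+x. h x \<partial>torus_measure) \<le> (L ^^ Suc n) h x + ennreal (a / 4)"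
proof -
  obtain s where s: "set s \<subseteq> {1..M}" "length s \<le> n" "\<rho> * (A * \<epsilon>) \<le> word_side s"
    and le: "\<And>h. h \<in> borel_measurable borel \<Longrightarrow> ennreal a * cyl_avg s h \<le> L h x"
    unfolding a_def using L_ge_cyl_avg[OF b A(1-3) c, where x = x] by blast
  have a: "0 \<le> a" using b A c by (simp add: a_def)
  have "noise_size * \<epsilon> * \<kappa> / ((1 - \<kappa>) * word_side s) \<le> noise_size * \<epsilon> * \<kappa> / ((1 - \<kappa>) * (\<rho> * (A * \<epsilon>)))"
    using b A s eps noise_size_nonneg word_side_pos[OF s(1)] by (intro divide_left_mono mult_left_mono mult_pos_pos mult_nonneg_nonneg) auto
  also have "\<dots> = (noise_size * \<kappa>) * \<epsilon> / (((1 - \<kappa>) * \<rho> * A) * \<epsilon>)" by (simp add: ac_simps)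
  also have "\<dots> = noise_size * \<kappa> / ((1 - \<kappa>) * \<rho> * A)" using eps by simp
  also have "\<dots> \<le> 1 / 4" by (rule A(4))
  finally have err: "noise_size * \<epsilon> * \<kappa> / ((1 - \<kappa>) * word_side s) \<le> 1 / 4" .
  have "(\<integral>\<^sup>+x. h x \<partial>torus_measure) \<le> cyl_avg s ((L ^^ n) h) + ennreal (noise_size * \<epsilon> * \<kappa> / ((1 - \<kappa>) * word_side s))"
    by (rule cyl_avg_iterate) (use b h s in auto)
  also have "\<dots> \<le> cyl_avg s ((L ^^ n) h) + ennreal (1 / 4)"
    using err by (intro add_left_mono ennreal_leI)
  finally have "ennreal a * (\<integral>\<^sup>+x. h x \<partial>torus_measure) \<le> ennreal a * cyl_avg s ((L ^^ n) h) + ennreal a * ennreal (1 / 4)"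
    by (metis distrib_left mult_left_mono zero_le)
  also have "ennreal a * cyl_avg s ((L ^^ n) h) \<le> L ((L ^^ n) h) x"
    by (rule le) (rule L_pow_props(1)[OF h])
  also have "ennreal a * ennreal (1 / 4) = ennreal (a / 4)"
    using a by (simp add: ennreal_mult[symmetric])
  finally show ?thesis by (simp add: add_right_mono)
qed

end

section \<open>Contraction of oscillations\<close>

text \<open>The same Markov operator on bounded real observables, where differences make sense.\<close>

definition mean_step :: "('d::finite torus \<Rightarrow> 'd torus) \<Rightarrow> 'd torus measure \<Rightarrow> ('d torus \<Rightarrow> real) \<Rightarrow> 'd torus \<Rightarrow> real" where
  "mean_step f Q g x = (\<integral>z. g (f x + z) \<partial>Q)"

definition test_fun :: "('d::finite torus \<Rightarrow> real) \<Rightarrow> bool" where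
  "test_fun g \<longleftrightarrow> g \<in> borel_measurable borel \<and> (\<forall>x. 0 \<le> g x \<and> g x \<le> 1)"

lemma test_fun_measurable: "test_fun g \<Longrightarrow> g \<in> borel_measurable borel"
  by (simp add: test_fun_def)

locale torus_walk =
  fixes f :: "'d::finite torus \<Rightarrow> 'd torus" and Q :: "'d torus measure"
  assumes f_meas [measurable]: "f \<in> borel_measurable borel"
    and Q_prob: "prob_space Q" and Q_sets [measurable_cong, simp]: "sets Q = sets borel"
begin

interpretation Q: prob_space Q by (rule Q_prob)

abbreviation "L \<equiv> transition f Q"
abbreviation "R \<equiv> mean_step f Q"

lemma integrable_test_fun:
  assumes "test_fun g"
  shows "integrable Q (\<lambda>z. g (f x + z))"
proof -
  note [measurable] = test_fun_measurable[OF assms]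
  show ?thesis using assms by (intro Q.integrable_const_bound[of _ 1]) (auto simp: test_fun_def)
qed

lemma test_fun_R: "test_fun g \<Longrightarrow> test_fun (R g)"
proof -
  assume g: "test_fun g"
  note [measurable] = test_fun_measurable[OF g]
  have "R g \<in> borel_measurable borel" unfolding mean_step_def[abs_def] by measurable
  moreover have "0 \<le> R g x" for x unfolding mean_step_def using g by (intro integral_nonneg_AE) (simp add: test_fun_def)
  moreover have "R g x \<le> 1" for x unfolding mean_step_def
    using g by (intro Q.integral_le_const integrable_test_fun) (auto simp: test_fun_def)
  ultimately show ?thesis by (simp add: test_fun_def)
qed

lemma ennreal_R: "test_fun g \<Longrightarrow> ennreal (R g x) = L (\<lambda>x. ennreal (g x)) x"
  unfolding mean_step_def transition_def
  by (rule nn_integral_eq_integral[symmetric, OF integrable_test_fun]) (auto simp: test_fun_def)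

lemma R_affine: "test_fun g \<Longrightarrow> R (\<lambda>x. a + b * g x) = (\<lambda>x. a + b * R g x)"
  unfolding mean_step_def using integrable_test_fun[of g] by (auto simp: Q.prob_space)

lemma test_fun_R_pow: "test_fun g \<Longrightarrow> test_fun ((R ^^ n) g)"
  by (induction n) (auto intro: test_fun_R)

lemma R_pow_affine: "test_fun g \<Longrightarrow> (R ^^ n) (\<lambda>x. a + b * g x) = (\<lambda>x. a + b * (R ^^ n) g x)"
  by (induction n) (auto simp: R_affine test_fun_R_pow)

lemma ennreal_R_pow: "test_fun g \<Longrightarrow> (\<lambda>x. ennreal ((R ^^ n) g x)) = (L ^^ n) (\<lambda>x. ennreal (g x))"
  by (induction n) (auto simp: ennreal_R test_fun_R_pow)

text \<open>An observable with oscillation \<open>b\<close> is an affine image of a test function, and the Markov operator commutes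
with affine maps.\<close>

lemma contraction_step:
  assumes one: "\<And>g x y. test_fun g \<Longrightarrow> (R ^^ N) g x - (R ^^ N) g y \<le> q"
    and g: "test_fun g" and osc: "\<And>x y. g x - g y \<le> b"
  shows "(R ^^ N) g x - (R ^^ N) g y \<le> q * b"
proof -
  have b0: "0 \<le> b" using osc[of x x] by simp
  have bdd: "bdd_below (range g)" using g by (auto simp: test_fun_def intro: bdd_belowI[of _ 0])
  \<comment> \<open>For \<open>b = 0\<close> the function \<open>g\<close> equals the constant \<open>a\<close>, and division by zero yields the test function 0.\<close>
  define a where "a = Inf (range g)"
  have a: "a \<le> g x" for x unfolding a_def by (rule cInf_lower[OF _ bdd]) simp
  have ab: "g x \<le> a + b" for x
  proof -
    have "g x - b \<le> a" unfolding a_def by (rule cInf_greatest) (use osc in \<open>auto simp: algebra_simps\<close>)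
    then show ?thesis by simp
  qed
  define g' where "g' x = (g x - a) / b" for x
  note [measurable] = test_fun_measurable[OF g]
  have g': "test_fun g'"
    unfolding test_fun_def
  proof (intro conjI allI)
    show "g' \<in> borel_measurable borel" unfolding g'_def[abs_def] by measurable
    show "0 \<le> g' x" "g' x \<le> 1" for x using a[of x] ab[of x] b0 by (auto simp: g'_def divide_le_eq)
  qed
  have "g x = a + b * g' x" for x using a[of x] ab[of x] by (cases "b = 0") (auto simp: g'_def)
  then have "g = (\<lambda>x. a + b * g' x)" by auto
  then have "(R ^^ N) g = (\<lambda>x. a + b * (R ^^ N) g' x)" using R_pow_affine[OF g'] by simp
  then have "(R ^^ N) g x - (R ^^ N) g y = b * ((R ^^ N) g' x - (R ^^ N) g' y)" by (simp add: algebra_simps)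
  also have "\<dots> \<le> b * q" using one[OF g'] b0 by (intro mult_left_mono)
  finally show ?thesis by (simp add: mult.commute)
qed

lemma contraction:
  assumes one: "\<And>g x y. test_fun g \<Longrightarrow> (R ^^ N) g x - (R ^^ N) g y \<le> q" and g: "test_fun g"
  shows "(R ^^ (N * k)) g x - (R ^^ (N * k)) g y \<le> q ^ k"
proof (induction k arbitrary: x y)
  case 0
  then show ?case using g by (auto simp: test_fun_def) (smt (verit, best))
next
  case (Suc k)
  have "(R ^^ N) ((R ^^ (N * k)) g) x - (R ^^ N) ((R ^^ (N * k)) g) y \<le> q * q ^ k"
    by (rule contraction_step[OF one test_fun_R_pow[OF g] Suc.IH])
  then show ?case by (simp add: funpow_add)
qed

text \<open>The chains started at \<open>x\<close> and at \<open>y\<close> share a part of their laws. Formally, the minorization is applied to \<open>g\<close>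
at \<open>y\<close> and to \<open>1 - g\<close> at \<open>x\<close>, and the two inequalities are added.\<close>

lemma minorization_imp_oscillation:
  assumes "prob_space \<nu>" "sets \<nu> = sets borel"
    and mino: "\<And>h x. h \<in> borel_measurable borel \<Longrightarrow> (\<And>x. h x \<le> 1) \<Longrightarrow>
      ennreal a * (\<integral>\<^sup>+x. h x \<partial>\<nu>) \<le> (L ^^ N) h x + ennreal (a / 4)"
    and a: "0 \<le> a" and g: "test_fun g"
  shows "(R ^^ N) g x - (R ^^ N) g y \<le> 1 - a / 2"
proof -
  interpret V: prob_space \<nu> by fact
  have int: "integrable \<nu> g" if "test_fun g" for g
    using that assms(2) by (intro V.integrable_const_bound[of _ 1]) (auto simp: test_fun_def cong: measurable_cong_sets)
  have lower: "a * (\<integral>x. g x \<partial>\<nu>) \<le> (R ^^ N) g x + a / 4" if g: "test_fun g" for g x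
  proof -
    have nn: "0 \<le> (\<integral>x. g x \<partial>\<nu>)" using g by (intro integral_nonneg_AE) (simp add: test_fun_def)
    have R0: "0 \<le> (R ^^ N) g x" using test_fun_R_pow[OF g] by (simp add: test_fun_def)
    have "ennreal (a * (\<integral>x. g x \<partial>\<nu>)) = ennreal a * (\<integral>\<^sup>+x. ennreal (g x) \<partial>\<nu>)"
      using a nn g by (simp add: ennreal_mult nn_integral_eq_integral[OF int[OF g]] test_fun_def)
    also have "\<dots> \<le> (L ^^ N) (\<lambda>x. ennreal (g x)) x + ennreal (a / 4)"
      using g by (intro mino) (auto simp: test_fun_def)
    also have "\<dots> = ennreal ((R ^^ N) g x + a / 4)"
      using a R0 ennreal_R_pow[OF g, of N, THEN fun_cong, of x] by simp
    finally show ?thesis using a R0 by (subst (asm) ennreal_le_iff) auto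
  qed
  have g1: "test_fun (\<lambda>x. 1 + (-1) * g x)" using g by (auto simp: test_fun_def)
  have "(\<integral>x. 1 + (-1) * g x \<partial>\<nu>) = 1 - (\<integral>x. g x \<partial>\<nu>)"
    using int[OF g] by (simp add: V.prob_space)
  then have "a * (1 - (\<integral>x. g x \<partial>\<nu>)) \<le> 1 - (R ^^ N) g x + a / 4"
    using lower[OF g1, of x] R_pow_affine[OF g, of N 1 "-1"] by simp
  then show ?thesis using lower[OF g, of y] by (simp add: algebra_simps)
qed

end

section \<open>The law of the process\<close>

context torus_walk begin

interpretation Q: prob_space Q by (rule Q_prob)

text \<open>The position at time \<open>n\<close> depends only on the first \<open>n\<close> noise variables.\<close>

lemma process_cong:
  "(\<And>k. k \<in> {1..n} \<Longrightarrow> z k = z' k) \<Longrightarrow> process f n (x, z) = process f n (x, z')"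
  by (induction n) auto

lemma measurable_process:
  assumes [measurable_cong]: "sets \<mu> = sets borel" and "{1..n} \<subseteq> I"
  shows "process f n \<in> borel_measurable (\<mu> \<Otimes>\<^sub>M (\<Pi>\<^sub>M n\<in>I. Q))"
  using assms(2)
proof (induction n)
  case 0
  have "fst \<in> borel_measurable (\<mu> \<Otimes>\<^sub>M (\<Pi>\<^sub>M n\<in>I. Q))"
    using measurable_fst[of \<mu>] assms(1) measurable_cong_sets by blast
  then show ?case by (simp add: fun_eq_iff[symmetric] cong: measurable_cong)
next
  case (Suc n)
  from Suc.prems have "{1..n} \<subseteq> I" by auto
  from Suc.IH[OF this] have [measurable]: "process f n \<in> borel_measurable (\<mu> \<Otimes>\<^sub>M (\<Pi>\<^sub>M n\<in>I. Q))" .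
  have "Suc n \<in> I" using Suc.prems by auto
  then have [measurable]: "(\<lambda>\<omega>. snd \<omega> (Suc n)) \<in> borel_measurable (\<mu> \<Otimes>\<^sub>M (\<Pi>\<^sub>M n\<in>I. Q))"
    by (intro measurable_compose[OF measurable_snd])
       (use measurable_component_singleton[of "Suc n" I "\<lambda>_. Q"] in \<open>simp cong: measurable_cong_sets\<close>)
  show ?case by simp
qed

lemma indep_noise:
  fixes P defines "P \<equiv> \<Pi>\<^sub>M n\<in>{1::nat..}. Q"
  shows "prob_space.indep_var P borel (\<lambda>z. process f n (x, z)) borel (\<lambda>z. z (Suc n))"
proof -
  interpret P: prob_space P unfolding P_def by (rule prob_space_PiM) (rule Q_prob)
  have rv: "\<And>i. i \<in> {1..} \<Longrightarrow> P.random_variable Q (\<lambda>z. z i)"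
    unfolding P_def by (rule measurable_component_singleton)
  have "P.indep_vars (\<lambda>_. Q) (\<lambda>i z. z i) {1..}"
  proof (subst P.indep_vars_iff_distr_eq_PiM'[OF _ rv])
    have "distr P (\<Pi>\<^sub>M i\<in>{1..}. Q) (\<lambda>z. \<lambda>i\<in>{1..}. z i) = distr P P (\<lambda>z. z)"
      unfolding P_def by (rule distr_cong) (auto simp: space_PiM PiE_def extensional_restrict)
    also have "\<dots> = P" by (rule distr_id)
    also have "\<dots> = (\<Pi>\<^sub>M i\<in>{1..}. distr P Q (\<lambda>z. z i))"
      unfolding P_def by (intro PiM_cong refl distr_PiM_component[symmetric] Q_prob)
    finally show "distr P (\<Pi>\<^sub>M i\<in>{1..}. Q) (\<lambda>z. \<lambda>i\<in>{1..}. z i) = (\<Pi>\<^sub>M i\<in>{1..}. distr P Q (\<lambda>z. z i))" .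
  qed auto
  from P.indep_var_restrict[OF this, of "{1..n}" "{Suc n}"]
  have ind: "P.indep_var (\<Pi>\<^sub>M i\<in>{1..n}. Q) (\<lambda>z. restrict (\<lambda>i. z i) {1..n}) (\<Pi>\<^sub>M i\<in>{Suc n}. Q) (\<lambda>z. restrict (\<lambda>i. z i) {Suc n})"
    by auto
  have m1: "(\<lambda>z. process f n (x, z)) \<in> (\<Pi>\<^sub>M i\<in>{1..n}. Q) \<rightarrow>\<^sub>M borel"
    by (rule measurable_compose[OF _ measurable_process[of borel n "{1..n}"]]) simp_all
  have m2: "(\<lambda>z. z (Suc n)) \<in> (\<Pi>\<^sub>M i\<in>{Suc n}. Q) \<rightarrow>\<^sub>M borel"
    using measurable_component_singleton[of "Suc n" "{Suc n}" "\<lambda>_. Q"] by (simp cong: measurable_cong_sets)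
  have "P.indep_var borel ((\<lambda>z. process f n (x, z)) \<circ> (\<lambda>z. restrict (\<lambda>i. z i) {1..n})) borel ((\<lambda>z. z (Suc n)) \<circ> (\<lambda>z. restrict (\<lambda>i. z i) {Suc n}))"
    by (rule P.indep_var_compose[OF ind m1 m2])
  moreover have "(\<lambda>z. process f n (x, z)) \<circ> (\<lambda>z. restrict (\<lambda>i. z i) {1..n}) = (\<lambda>z. process f n (x, z))"
    by (auto simp: fun_eq_iff intro!: process_cong)
  moreover have "(\<lambda>z. z (Suc n)) \<circ> (\<lambda>z. restrict (\<lambda>i. z i) {Suc n}) = (\<lambda>z::nat \<Rightarrow> 'd torus. z (Suc n))"
    by (auto simp: fun_eq_iff)
  ultimately show ?thesis by (simp only:)
qed

text \<open>The Markov property: for each fixed starting point, the position at time \<open>n\<close> is independent of the next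
noise variable.\<close>

lemma nn_integral_process_Suc:
  assumes \<mu>: "prob_space \<mu>" and \<mu>_sets [measurable_cong]: "sets \<mu> = sets borel"
    and [measurable]: "h \<in> borel_measurable borel"
  shows "(\<integral>\<^sup>+\<omega>. h (process f (Suc n) \<omega>) \<partial>path_space \<mu> Q) = (\<integral>\<^sup>+\<omega>. L h (process f n \<omega>) \<partial>path_space \<mu> Q)"
proof -
  define P where "P = (\<Pi>\<^sub>M n\<in>{1::nat..}. Q)"
  interpret P: prob_space P unfolding P_def by (rule prob_space_PiM) (rule Q_prob)
  have Lh: "L h \<in> borel_measurable borel"
    by (rule measurable_transition) (auto intro: prob_space_imp_sigma_finite Q_prob)
  have mp: "process f n \<in> borel_measurable (\<mu> \<Otimes>\<^sub>M P)" for n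
    unfolding P_def by (rule measurable_process[OF \<mu>_sets]) auto
  have inner: "(\<integral>\<^sup>+z. h (process f (Suc n) (x, z)) \<partial>P) = (\<integral>\<^sup>+z. L h (process f n (x, z)) \<partial>P)" for x
  proof -
    let ?X = "\<lambda>z. process f n (x, z)" and ?Y = "\<lambda>z. z (Suc n)"
    have ind: "P.indep_var borel ?X borel ?Y" unfolding P_def by (rule indep_noise)
    note eq = ind[unfolded P.indep_var_distribution_eq]
    have [measurable]: "?X \<in> borel_measurable P" "?Y \<in> borel_measurable P" using eq by auto
    have Y: "distr P borel ?Y = Q"
    proof -
      have "distr P borel ?Y = distr P Q ?Y" by (rule distr_cong) simp_all
      also have "\<dots> = Q" unfolding P_def by (rule distr_PiM_component) (auto intro: Q_prob)
      finally show ?thesis .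
    qed
    have "(\<integral>\<^sup>+z. h (process f (Suc n) (x, z)) \<partial>P) = (\<integral>\<^sup>+p. h (f (fst p) + snd p) \<partial>distr P (borel \<Otimes>\<^sub>M borel) (\<lambda>z. (?X z, ?Y z)))"
      by (subst nn_integral_distr) simp_all
    also have "\<dots> = (\<integral>\<^sup>+p. h (f (fst p) + snd p) \<partial>(distr P borel ?X \<Otimes>\<^sub>M Q))"
      using eq Y by simp
    also have "\<dots> = (\<integral>\<^sup>+a. (\<integral>\<^sup>+b. h (f a + b) \<partial>Q) \<partial>distr P borel ?X)"
      by (subst Q.nn_integral_fst[symmetric]) simp_all
    also have "\<dots> = (\<integral>\<^sup>+z. L h (process f n (x, z)) \<partial>P)"
      using Lh by (subst nn_integral_distr) (simp_all add: transition_def[symmetric])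
    finally show ?thesis .
  qed
  have "(\<integral>\<^sup>+\<omega>. h (process f (Suc n) \<omega>) \<partial>(\<mu> \<Otimes>\<^sub>M P)) = (\<integral>\<^sup>+x. \<integral>\<^sup>+z. h (process f (Suc n) (x, z)) \<partial>P \<partial>\<mu>)"
    by (rule P.nn_integral_fst[symmetric]) (use mp[of "Suc n"] in measurable)
  also have "\<dots> = (\<integral>\<^sup>+x. \<integral>\<^sup>+z. L h (process f n (x, z)) \<partial>P \<partial>\<mu>)" by (simp only: inner)
  also have "\<dots> = (\<integral>\<^sup>+\<omega>. L h (process f n \<omega>) \<partial>(\<mu> \<Otimes>\<^sub>M P))"
    by (rule P.nn_integral_fst) (use mp[of n] Lh in measurable)
  finally show ?thesis by (simp add: path_space_def P_def)
qed

lemma nn_integral_process: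
  assumes \<mu>: "prob_space \<mu>" and \<mu>_sets [measurable_cong]: "sets \<mu> = sets borel"
    and h: "h \<in> borel_measurable borel"
  shows "(\<integral>\<^sup>+\<omega>. h (process f n \<omega>) \<partial>path_space \<mu> Q) = (\<integral>\<^sup>+x. (L ^^ n) h x \<partial>\<mu>)"
  using h
proof (induction n arbitrary: h)
  case 0
  note [measurable] = 0
  define P where "P = (\<Pi>\<^sub>M n\<in>{1::nat..}. Q)"
  interpret P: prob_space P unfolding P_def by (rule prob_space_PiM) (rule Q_prob)
  have "(\<integral>\<^sup>+\<omega>. h (fst \<omega>) \<partial>path_space \<mu> Q) = (\<integral>\<^sup>+x. h x \<partial>\<mu>)"
    unfolding path_space_def P_def[symmetric]
    by (subst P.nn_integral_fst[symmetric]) (simp_all add: P.emeasure_space_1)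
  then show ?case by simp
next
  case (Suc n)
  note [measurable] = Suc.prems
  have "L h \<in> borel_measurable borel"
    by (rule measurable_transition) (auto intro: prob_space_imp_sigma_finite Q_prob)
  from Suc.IH[OF this] show ?case
    unfolding nn_integral_process_Suc[OF \<mu> \<mu>_sets Suc.prems] by (simp add: funpow_swap1)
qed

lemma emeasure_process_dist:
  assumes \<mu>: "prob_space \<mu>" and \<mu>_sets: "sets \<mu> = sets borel" and A [measurable]: "A \<in> sets borel"
  shows "emeasure (process_dist f Q \<mu> n) A = (\<integral>\<^sup>+x. (L ^^ n) (indicator A) x \<partial>\<mu>)"
proof -
  have [measurable]: "process f n \<in> borel_measurable (path_space \<mu> Q)"
    unfolding path_space_def by (rule measurable_process[OF \<mu>_sets]) auto
  have "emeasure (process_dist f Q \<mu> n) A = (\<integral>\<^sup>+\<omega>. indicator A \<omega> \<partial>process_dist f Q \<mu> n)"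
    by (simp add: process_dist_def)
  also have "\<dots> = (\<integral>\<^sup>+\<omega>. indicator A (process f n \<omega>) \<partial>path_space \<mu> Q)"
    unfolding process_dist_def by (subst nn_integral_distr) simp_all
  finally show ?thesis using nn_integral_process[OF \<mu> \<mu>_sets, of "indicator A"] by simp
qed

lemma measure_process_dist:
  assumes \<mu>: "prob_space \<mu>" and \<mu>_sets: "sets \<mu> = sets borel" and A: "A \<in> sets borel"
  shows "measure (process_dist f Q \<mu> n) A = (\<integral>x. (R ^^ n) (indicator A) x \<partial>\<mu>)"
proof -
  interpret \<mu>: prob_space \<mu> by fact
  have g: "test_fun (indicator A)" using A by (auto simp: test_fun_def indicator_def)
  note t = test_fun_R_pow[OF g, of n]
  have int: "integrable \<mu> ((R ^^ n) (indicator A))"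
    using t \<mu>_sets by (intro \<mu>.integrable_const_bound[of _ 1]) (auto simp: test_fun_def cong: measurable_cong_sets)
  have "emeasure (process_dist f Q \<mu> n) A = (\<integral>\<^sup>+x. ennreal ((R ^^ n) (indicator A) x) \<partial>\<mu>)"
    unfolding emeasure_process_dist[OF assms] ennreal_R_pow[OF g] by (simp add: ennreal_indicator)
  also have "\<dots> = ennreal (\<integral>x. (R ^^ n) (indicator A) x \<partial>\<mu>)"
    using t by (intro nn_integral_eq_integral int) (simp add: test_fun_def)
  finally show ?thesis
    using t by (simp add: measure_def test_fun_def integral_nonneg_AE)
qed

text \<open>The difference between the law at time \<open>n\<close> and the stationary measure on a set \<open>A\<close> is a difference of two
averages of the same function, \<open>(R ^^ n) (indicator A)\<close>; hence it is at most the oscillation of that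
function.\<close>

lemma mixing_time_le:
  assumes stat: "\<And>h. h \<in> borel_measurable borel \<Longrightarrow> (\<integral>\<^sup>+x. L h x \<partial>torus_measure) = (\<integral>\<^sup>+x. h x \<partial>torus_measure)"
    and osc: "\<And>g x y. test_fun g \<Longrightarrow> (R ^^ n) g x - (R ^^ n) g y \<le> \<delta>"
  shows "mixing_time f Q \<delta> \<le> enat n"
proof -
  let ?\<nu> = "torus_measure :: 'd torus measure"
  note \<nu> = prob_space_torus_measure sets_torus_measure
  interpret V: prob_space ?\<nu> by (rule prob_space_torus_measure)
  have "tv_dist (process_dist f Q \<mu> n) ?\<nu> \<le> \<delta>" if \<mu>: "prob_space \<mu>" "sets \<mu> = sets borel" for \<mu>
    unfolding tv_dist_def
  proof (rule cSUP_least)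
    fix A assume "A \<in> sets ?\<nu>"
    then have A [measurable]: "A \<in> sets borel" by simp
    interpret \<mu>: prob_space \<mu> by fact
    have g: "test_fun (indicator A)" using A by (auto simp: test_fun_def indicator_def)
    define G where "G = (R ^^ n) (indicator A)"
    have G: "test_fun G" unfolding G_def by (rule test_fun_R_pow[OF g])
    have i\<mu>: "integrable \<mu> G" and i\<nu>: "integrable ?\<nu> G"
      using G \<mu> by (auto intro!: \<mu>.integrable_const_bound[of _ 1] V.integrable_const_bound[of _ 1] simp: test_fun_def cong: measurable_cong_sets)
    have Lm: "(L ^^ k) (indicator A) \<in> borel_measurable borel" for k
      by (induction k) (auto intro!: measurable_transition prob_space_imp_sigma_finite Q_prob)
    have "(\<integral>\<^sup>+x. (L ^^ k) (indicator A) x \<partial>torus_measure) = emeasure ?\<nu> A" for k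
      using Lm by (induction k) (simp_all add: stat)
    then have "emeasure ?\<nu> A = emeasure (process_dist f Q ?\<nu> n) A"
      using emeasure_process_dist[OF \<nu> A] by simp
    then have mA: "measure ?\<nu> A = (\<integral>x. G x \<partial>torus_measure)"
      using measure_process_dist[OF \<nu> A] by (simp add: measure_def G_def)
    have up: "(\<integral>x. G x \<partial>M1) \<le> (\<integral>x. G x \<partial>M2) + \<delta>"
      if "prob_space M1" "prob_space M2" "integrable M1 G" "integrable M2 G" for M1 M2 :: "'d torus measure"
    proof -
      interpret M1: prob_space M1 by fact
      interpret M2: prob_space M2 by fact
      have "(\<integral>x. G x \<partial>M1) - \<delta> \<le> G y" for y
      proof -
        have "(\<integral>x. G x \<partial>M1) \<le> G y + \<delta>"
          using osc[OF g, of _ y] that by (intro M1.integral_le_const) (auto simp: G_def algebra_simps)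
        then show ?thesis by simp
      qed
      then have "(\<integral>x. G x \<partial>M1) - \<delta> \<le> (\<integral>x. G x \<partial>M2)"
        using that by (intro M2.integral_ge_const) auto
      then show ?thesis by simp
    qed
    have "measure (process_dist f Q \<mu> n) A = (\<integral>x. G x \<partial>\<mu>)"
      unfolding G_def by (rule measure_process_dist[OF \<mu> A])
    then show "\<bar>measure (process_dist f Q \<mu> n) A - measure ?\<nu> A\<bar> \<le> \<delta>"
      using up[OF \<mu>(1) \<nu>(1) i\<mu> i\<nu>] up[OF \<nu>(1) \<mu>(1) i\<nu> i\<mu>] mA by linarith
  qed auto
  then show ?thesis
    unfolding mixing_time_def by (intro Inf_lower imageI) auto
qed

end

section \<open>The mixing time\<close>

sublocale noisy_bernoulli \<subseteq> walk: torus_walk \<phi> Q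
  by (intro torus_walk.intro measurable_bernoulli_map prob_space_Q sets_Q)

context noisy_bernoulli begin

lemma t_mix_le:
  assumes b: "0 < \<rho>" "\<rho> \<le> 1" "0 < \<kappa>" "\<kappa> < 1" "\<And>i. i \<in> {1..M} \<Longrightarrow> \<rho> \<le> side i \<and> side i \<le> \<kappa>"
    and A: "0 < A" "\<kappa> ^ n \<le> A * \<epsilon>" "A * \<epsilon> \<le> 1" "noise_size * \<kappa> / ((1 - \<kappa>) * \<rho> * A) \<le> 1 / 4"
    and c: "0 \<le> c" "\<And>w. norm w \<le> A * real CARD('d) \<Longrightarrow> c \<le> K w"
    and k: "(1 - c * (\<rho> * A) ^ CARD('d) / 2) ^ k \<le> 1 / 2"
  shows "t_mix \<phi> Q \<le> enat (Suc n * k)"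
proof (rule walk.mixing_time_le)
  show "(\<integral>\<^sup>+x. L h x \<partial>torus_measure) = (\<integral>\<^sup>+x. h x \<partial>torus_measure)" if "h \<in> borel_measurable borel" for h
    by (rule torus_measure_stationary[OF that])
  fix g :: "'d torus \<Rightarrow> real" and x y assume g: "test_fun g"
  let ?a = "c * (\<rho> * A) ^ CARD('d)"
  have "(walk.R ^^ Suc n) g x - (walk.R ^^ Suc n) g y \<le> 1 - ?a / 2" if g: "test_fun g" for g x y
    by (rule walk.minorization_imp_oscillation[OF prob_space_torus_measure sets_torus_measure doeblin[OF b A c] _ g])
       (use b A c in auto)
  from walk.contraction[OF this g, of k x y] k
  show "(walk.R ^^ (Suc n * k)) g x - (walk.R ^^ (Suc n * k)) g y \<le> 1 / 2" by linarith
qed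

end

text \<open>The constants are chosen in this order: \<open>A\<close> so large that the errors of the noise sum up to at most
\<open>1 / 4\<close>; then the lower bound \<open>c\<close> of the density on the ball of radius \<open>A CARD('d)\<close>; then the number \<open>k\<close> of
rounds that bring the oscillation down to \<open>1 / 2\<close>. None of them depends on \<open>\<epsilon>\<close>. One round takes \<open>n + 1\<close>
steps, where \<open>n\<close> is the depth at which cylinders have side at most \<open>A \<epsilon>\<close>, and this depth is logarithmic
in \<open>1 / \<epsilon>\<close>.\<close>

lemma t_mix_regular_density:
  fixes E :: "nat \<Rightarrow> (real^'d::finite) set"
  assumes data: "bernoulli_data M E D e" and K: "regular_density K"
  shows "\<exists>C::real. \<forall>\<^sub>F \<epsilon> in at_right 0.
    ereal_of_enat (t_mix (bernoulli_map M E D e) (noise_law K \<epsilon>)) \<le> ereal (C * \<bar>ln \<epsilon>\<bar>)"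
proof -
  interpret bernoulli M E D e by unfold_locales (rule data)
  obtain \<rho> \<kappa> where b: "0 < \<rho>" "\<rho> \<le> 1" "0 < \<kappa>" "\<kappa> < 1"
    "\<And>i. i \<in> {1..M} \<Longrightarrow> \<rho> \<le> side i \<and> side i \<le> \<kappa>"
    by (rule side_bounds) auto
  define m where "m = real CARD('d) * enn2real (\<integral>\<^sup>+w. ennreal (norm w * K w) \<partial>lborel)"
  define A where "A = max 1 (4 * m * \<kappa> / ((1 - \<kappa>) * \<rho>))"
  have A: "1 \<le> A" "4 * m * \<kappa> / ((1 - \<kappa>) * \<rho>) \<le> A" by (simp_all add: A_def)
  have mA: "m * \<kappa> / ((1 - \<kappa>) * \<rho> * A) \<le> 1 / 4"
    using A b by (simp add: field_simps)
  obtain c where c: "0 < c" "\<And>w. norm w \<le> A * real CARD('d) \<Longrightarrow> c \<le> K w"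
    using K unfolding regular_density_def by blast
  define V where "V = (\<rho> * A) ^ CARD('d)"
  have "0 < c * V" using b A c by (simp add: V_def)
  then have "1 - c * V / 2 < 1" by simp
  then obtain k where "(1 - c * V / 2) ^ k < 1 / 2"
    using real_arch_pow_inv[of "1 / 2" "1 - c * V / 2"] by auto
  then have k: "(1 - c * V / 2) ^ k \<le> 1 / 2" by simp
  define l where "l = ln (1 / \<kappa>)"
  have l: "0 < l" using b by (simp add: l_def)
  have main: "ereal_of_enat (t_mix \<phi> (noise_law K \<epsilon>)) \<le> ereal (real k * (1 / l + 2) * \<bar>ln \<epsilon>\<bar>)"
    if small: "0 < \<epsilon>" "\<epsilon> < 1 / A" "\<epsilon> < exp (-1)" for \<epsilon>
  proof -
    interpret noisy_bernoulli M E D e K \<epsilon> by unfold_locales (use K small in auto)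
    define n where "n = nat \<lceil>ln (1 / (A * \<epsilon>)) / l\<rceil>"
    have "\<epsilon> * A < 1" using small(2) A(1) by (simp add: pos_less_divide_eq)
    then have A\<epsilon>: "0 < A * \<epsilon>" "A * \<epsilon> \<le> 1" using A small(1) by (simp_all add: mult.commute)
    have ln1: "ln (1 / (A * \<epsilon>)) = - ln (A * \<epsilon>)" using A small(1) by (simp add: ln_div)
    have lnn: "0 \<le> ln (1 / (A * \<epsilon>))" using A\<epsilon> by simp
    have n1: "ln (1 / (A * \<epsilon>)) / l \<le> real n" unfolding n_def by linarith
    have n2: "real n \<le> ln (1 / (A * \<epsilon>)) / l + 1"
    proof -
      have "0 \<le> ln (1 / (A * \<epsilon>)) / l" using lnn l by simp
      then show ?thesis unfolding n_def by linarith
    qed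
    have "\<kappa> ^ n \<le> A * \<epsilon>"
    proof -
      have "ln (\<kappa> ^ n) = - (real n * l)" using b by (simp add: ln_realpow l_def ln_div)
      also have "\<dots> \<le> ln (A * \<epsilon>)" using n1 l unfolding ln1 by (simp add: field_simps)
      finally show ?thesis using b A\<epsilon> by (subst (asm) ln_le_cancel_iff) auto
    qed
    then have "t_mix \<phi> Q \<le> enat (Suc n * k)"
      using t_mix_le[OF b, of A n c k] A A\<epsilon> mA c k by (simp add: noise_size_def m_def V_def)
    then have "ereal_of_enat (t_mix \<phi> Q) \<le> ereal_of_enat (enat (Suc n * k))"
      by (simp only: ereal_of_enat_le_iff)
    also have "\<dots> = ereal (real (Suc n * k))" by simp
    also have "\<dots> \<le> ereal (real k * (1 / l + 2) * \<bar>ln \<epsilon>\<bar>)"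
    proof -
      have "ln \<epsilon> < - 1" using small by (metis ln_exp ln_less_cancel_iff exp_gt_zero)
      then have abs: "\<bar>ln \<epsilon>\<bar> = - ln \<epsilon>" "1 \<le> \<bar>ln \<epsilon>\<bar>" by auto
      have "ln (1 / (A * \<epsilon>)) = - ln A - ln \<epsilon>" using A small by (simp add: ln1 ln_mult)
      also have "\<dots> \<le> \<bar>ln \<epsilon>\<bar>" using A by (simp add: abs)
      finally have "ln (1 / (A * \<epsilon>)) / l \<le> \<bar>ln \<epsilon>\<bar> / l" using l by (simp add: divide_right_mono)
      then have "real (Suc n) \<le> \<bar>ln \<epsilon>\<bar> / l + 2 * \<bar>ln \<epsilon>\<bar>" using n2 abs by simp
      then have "real k * real (Suc n) \<le> real k * (\<bar>ln \<epsilon>\<bar> / l + 2 * \<bar>ln \<epsilon>\<bar>)" by (intro mult_left_mono) auto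
      also have "\<dots> = real k * (1 / l + 2) * \<bar>ln \<epsilon>\<bar>" by (simp add: field_simps)
      also have "real k * real (Suc n) = real (Suc n * k)" by (simp only: of_nat_mult mult.commute)
      finally show ?thesis by (simp only: ereal_less_eq)
    qed
    finally show ?thesis .
  qed
  \<comment> \<open>\<open>\<epsilon> < 1 / A\<close> makes \<open>A \<epsilon>\<close> a possible side of a cylinder, and \<open>\<epsilon> < exp (-1)\<close> makes \<open>\<bar>ln \<epsilon>\<bar>\<close> at least 1,
which absorbs the additive constants.\<close>
  define \<epsilon>0 where "\<epsilon>0 = min (1 / A) (exp (-1))"
  have "0 < \<epsilon>0" using A by (simp add: \<epsilon>0_def)
  have "\<forall>\<^sub>F \<epsilon> in at_right 0. ereal_of_enat (t_mix \<phi> (noise_law K \<epsilon>)) \<le> ereal (real k * (1 / l + 2) * \<bar>ln \<epsilon>\<bar>)"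
    unfolding eventually_at_right_field
    by (rule exI[of _ \<epsilon>0]) (use \<open>0 < \<epsilon>0\<close> main in \<open>auto simp: \<epsilon>0_def\<close>)
  then show ?thesis by blast
qed

section \<open>Densities with product structure\<close>

lemma nn_integral_vec_prod:
  fixes f :: "'d::finite \<Rightarrow> real \<Rightarrow> ennreal"
  assumes f: "\<And>j. f j \<in> borel_measurable borel"
  shows "(\<integral>\<^sup>+x. (\<Prod>j\<in>UNIV. f j (x $ j)) \<partial>(lborel :: (real^'d) measure)) = (\<Prod>j\<in>UNIV. \<integral>\<^sup>+t. f j t \<partial>lborel)"
proof -
  define idx :: "real^'d \<Rightarrow> 'd" where "idx b = (SOME j. b = axis j 1)" for b
  have idx: "idx (axis j 1) = j" for j
    unfolding idx_def by (rule some_equality) (auto simp: axis_eq_axis)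
  have B: "(Basis :: (real^'d) set) = (\<lambda>j. axis j 1) ` UNIV" by (auto simp: Basis_vec_def)
  have inj: "inj (\<lambda>j::'d. axis j (1::real))" by (auto simp: inj_on_def axis_eq_axis)
  have re: "(\<Prod>b\<in>(Basis :: (real^'d) set). g b) = (\<Prod>j\<in>UNIV. g (axis j 1))" for g :: "real^'d \<Rightarrow> ennreal"
    unfolding B by (rule prod.reindex[OF inj, unfolded o_def])
  have "(\<integral>\<^sup>+x. (\<Prod>b\<in>Basis. f (idx b) (x \<bullet> b)) \<partial>(lborel :: (real^'d) measure)) = (\<Prod>b\<in>(Basis::(real^'d) set). \<integral>\<^sup>+t. f (idx b) t \<partial>lborel)"
    by (rule nn_integral_lborel_prod) (use f in auto)
  then show ?thesis by (simp add: re idx cart_eq_inner_axis)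
qed

lemma nn_integral_vec_prod_moment:
  fixes k :: "'d::finite \<Rightarrow> real \<Rightarrow> real"
  assumes [measurable]: "\<And>j. k j \<in> borel_measurable borel" and nn: "\<And>j t. 0 \<le> k j t"
    and one: "\<And>j. (\<integral>\<^sup>+t. ennreal (k j t) \<partial>lborel) = 1"
  shows "(\<integral>\<^sup>+x. ennreal (\<bar>x $ l\<bar> * (\<Prod>j\<in>UNIV. k j (x $ j))) \<partial>(lborel :: (real^'d) measure)) = (\<integral>\<^sup>+t. ennreal (\<bar>t\<bar> * k l t) \<partial>lborel)"
proof -
  have "ennreal (\<bar>x $ l\<bar> * (\<Prod>j\<in>UNIV. k j (x $ j))) = (\<Prod>j\<in>UNIV. ennreal ((if j = l then \<bar>x $ j\<bar> else 1) * k j (x $ j)))" for x :: "real^'d"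
    using nn by (subst prod_ennreal) (simp_all add: prod.distrib prod.delta)
  then have "(\<integral>\<^sup>+x. ennreal (\<bar>x $ l\<bar> * (\<Prod>j\<in>UNIV. k j (x $ j))) \<partial>(lborel :: (real^'d) measure))
     = (\<Prod>j\<in>UNIV. \<integral>\<^sup>+t. ennreal ((if j = l then \<bar>t\<bar> else 1) * k j t) \<partial>lborel)"
    using nn_integral_vec_prod[of "\<lambda>j t. ennreal ((if j = l then \<bar>t\<bar> else 1) * k j t)"] by simp
  also have "\<dots> = (\<Prod>j\<in>UNIV. if j = l then \<integral>\<^sup>+t. ennreal (\<bar>t\<bar> * k j t) \<partial>lborel else 1)"
    by (intro prod.cong refl) (simp add: one)
  also have "\<dots> = (\<integral>\<^sup>+t. ennreal (\<bar>t\<bar> * k l t) \<partial>lborel)" by (simp add: prod.delta)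
  finally show ?thesis .
qed

lemma finite_first_moment:
  fixes K :: "real^'d::finite \<Rightarrow> real"
  assumes [measurable]: "K \<in> borel_measurable borel" and nn: "\<And>x. 0 \<le> K x"
    and fin: "\<And>j. (\<integral>\<^sup>+x. ennreal (\<bar>x $ j\<bar> * K x) \<partial>lborel) < \<infinity>"
  shows "(\<integral>\<^sup>+x. ennreal (norm x * K x) \<partial>lborel) < \<infinity>"
proof -
  have "(\<integral>\<^sup>+x. ennreal (norm x * K x) \<partial>lborel) \<le> (\<integral>\<^sup>+x. (\<Sum>j\<in>UNIV. ennreal (\<bar>x $ j\<bar> * K x)) \<partial>lborel)"
  proof (rule nn_integral_mono)
    fix x :: "real^'d"
    have "norm x * K x \<le> (\<Sum>j\<in>UNIV. \<bar>x $ j\<bar> * K x)"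
      using norm_le_l1_cart[of x] nn[of x] by (simp add: sum_distrib_right[symmetric] mult_right_mono)
    then show "ennreal (norm x * K x) \<le> (\<Sum>j\<in>UNIV. ennreal (\<bar>x $ j\<bar> * K x))"
      using nn by (simp add: sum_ennreal ennreal_leI)
  qed
  also have "\<dots> = (\<Sum>j\<in>UNIV. \<integral>\<^sup>+x. ennreal (\<bar>x $ j\<bar> * K x) \<partial>lborel)"
    by (rule nn_integral_sum) measurable
  also have "\<dots> < \<infinity>" using fin by (simp add: ennreal_sum_less_top)
  finally show ?thesis .
qed

text \<open>Moment bounds survive \<open>L\<^sup>1\<close> limits: the truncated weight \<open>min (w x) R\<close> is bounded, so its integrals converge;
then \<open>R\<close> tends to infinity by monotone convergence.\<close>

lemma truncated_moment_limit:
  fixes K :: "real^'d::finite \<Rightarrow> real" and S :: "nat \<Rightarrow> real^'d \<Rightarrow> real"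
  assumes [measurable]: "K \<in> borel_measurable borel" "w \<in> borel_measurable borel"
    and S [measurable]: "\<And>n. 1 \<le> n \<Longrightarrow> S n \<in> borel_measurable borel"
    and nn: "\<And>x. 0 \<le> K x" "\<And>n x. 1 \<le> n \<Longrightarrow> 0 \<le> S n x" "\<And>x. 0 \<le> w x"
    and lim: "(\<lambda>n. \<integral>\<^sup>+x. ennreal \<bar>S n x - K x\<bar> \<partial>lborel) \<longlonglongrightarrow> 0"
    and bound: "\<And>n. 1 \<le> n \<Longrightarrow> (\<integral>\<^sup>+x. ennreal (w x * S n x) \<partial>lborel) \<le> B"
  shows "(\<integral>\<^sup>+x. ennreal (w x * K x) \<partial>lborel) \<le> B"
proof -
  have trunc: "(\<integral>\<^sup>+x. ennreal (min (w x) (real R) * K x) \<partial>lborel) \<le> B" for R :: nat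
  proof -
    have step: "(\<integral>\<^sup>+x. ennreal (min (w x) (real R) * K x) \<partial>lborel)
        \<le> B + ennreal (real R) * (\<integral>\<^sup>+x. ennreal \<bar>S n x - K x\<bar> \<partial>lborel)" if n: "1 \<le> n" for n
    proof -
      note [measurable] = S[OF n]
      have "(\<integral>\<^sup>+x. ennreal (min (w x) (real R) * K x) \<partial>lborel)
        \<le> (\<integral>\<^sup>+x. ennreal (w x * S n x) + ennreal (real R) * ennreal \<bar>S n x - K x\<bar> \<partial>lborel)"
      proof (rule nn_integral_mono)
        fix x
        have "min (w x) (real R) * K x \<le> min (w x) (real R) * S n x + min (w x) (real R) * \<bar>S n x - K x\<bar>"
          using nn(3)[of x] by (subst distrib_left[symmetric], intro mult_left_mono) auto
        also have "\<dots> \<le> w x * S n x + real R * \<bar>S n x - K x\<bar>"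
          using nn(2)[OF n, of x] by (intro add_mono mult_right_mono) auto
        finally show "ennreal (min (w x) (real R) * K x) \<le> ennreal (w x * S n x) + ennreal (real R) * ennreal \<bar>S n x - K x\<bar>"
          using nn(2)[OF n, of x] nn(3)[of x]
          by (simp add: ennreal_plus[symmetric] ennreal_mult[symmetric] ennreal_leI del: ennreal_plus)
      qed
      also have "\<dots> = (\<integral>\<^sup>+x. ennreal (w x * S n x) \<partial>lborel) + ennreal (real R) * (\<integral>\<^sup>+x. ennreal \<bar>S n x - K x\<bar> \<partial>lborel)"
        by (subst nn_integral_add) (simp_all add: nn_integral_cmult)
      also have "\<dots> \<le> B + ennreal (real R) * (\<integral>\<^sup>+x. ennreal \<bar>S n x - K x\<bar> \<partial>lborel)"
        by (intro add_right_mono bound[OF n])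
      finally show ?thesis .
    qed
    have "(\<lambda>n. B + ennreal (real R) * (\<integral>\<^sup>+x. ennreal \<bar>S n x - K x\<bar> \<partial>lborel)) \<longlonglongrightarrow> B + ennreal (real R) * 0"
      by (intro tendsto_add tendsto_const ennreal_tendsto_cmult lim) simp
    then show ?thesis
      using step by (intro tendsto_lowerbound[of _ "B + ennreal (real R) * 0" sequentially, simplified])
        (auto simp: eventually_sequentially)
  qed
  have "(\<integral>\<^sup>+x. ennreal (w x * K x) \<partial>lborel) = (\<integral>\<^sup>+x. (SUP R. ennreal (min (w x) (real R) * K x)) \<partial>lborel)"
  proof (rule nn_integral_cong)
    fix x
    show "ennreal (w x * K x) = (SUP R. ennreal (min (w x) (real R) * K x))"
    proof (rule antisym)
      obtain R where "w x \<le> real R" using real_arch_simple by blast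
      then have "min (w x) (real R) = w x" by simp
      then show "ennreal (w x * K x) \<le> (SUP R. ennreal (min (w x) (real R) * K x))"
        by (metis SUP_upper UNIV_I)
      show "(SUP R. ennreal (min (w x) (real R) * K x)) \<le> ennreal (w x * K x)"
        using nn by (intro SUP_least ennreal_leI mult_right_mono) auto
    qed
  qed
  also have "\<dots> = (SUP R. \<integral>\<^sup>+x. ennreal (min (w x) (real R) * K x) \<partial>lborel)"
    using nn by (intro nn_integral_monotone_convergence_SUP)
      (auto intro!: ennreal_leI mult_right_mono simp: incseq_def le_fun_def min_def)
  also have "\<dots> \<le> B" by (intro SUP_least trunc)
  finally show ?thesis .
qed

text \<open>The lower bound on balls holds because every vector is the difference of its positive and negative
parts, which lie in a common cube. For the first moment, each approximating density is a convex
combination of product densities with coordinate moments at most \<open>A\<close>, and the bound passes to the limit.\<close>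

lemma separated_regular_density:
  fixes K :: "real^'d::finite \<Rightarrow> real"
  assumes "separated_assumption M E D e K"
  shows "regular_density K"
  unfolding regular_density_def
proof (intro conjI allI)
  show pd: "prob_density K" using assms by (simp add: separated_assumption_def)
  then have [measurable]: "K \<in> borel_measurable borel" and nn: "\<And>x. 0 \<le> K x" by (auto simp: prob_density_def)
  fix R :: real
  define \<eta> where "\<eta> = \<bar>R\<bar> + 1"
  let ?B = "{x::real^'d. \<forall>j. 0 \<le> x $ j \<and> x $ j < \<eta>}"
  have inf: "0 < (INF (x, y) \<in> ?B \<times> ?B. K (x - y))"
    using assms by (simp add: separated_assumption_def \<eta>_def)
  show "\<exists>c>0. \<forall>x. norm x \<le> R \<longrightarrow> c \<le> K x"
  proof (intro exI[of _ "INF (x, y) \<in> ?B \<times> ?B. K (x - y)"] conjI inf allI impI)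
    fix x :: "real^'d" assume x: "norm x \<le> R"
    have c: "\<bar>x $ j\<bar> < \<eta>" for j using component_le_norm_cart[of x j] x by (simp add: \<eta>_def)
    define p where "p = (\<chi> j. max (x $ j) 0)"
    define m where "m = (\<chi> j. max (- x $ j) 0)"
    have \<eta>: "0 < \<eta>" by (simp add: \<eta>_def)
    have "p \<in> ?B" "m \<in> ?B" using c \<eta> by (auto simp: p_def m_def abs_less_iff)
    moreover have "x = p - m" by (auto simp: p_def m_def vec_eq_iff)
    ultimately show "(INF (x, y) \<in> ?B \<times> ?B. K (x - y)) \<le> K x"
      by (intro cINF_lower2[where x = "(p, m)"]) (auto intro!: bdd_belowI[of _ 0] nn)
  qed
next
  have pd: "prob_density K" using assms by (simp add: separated_assumption_def)
  then have [measurable]: "K \<in> borel_measurable borel" and nn: "\<And>x. 0 \<le> K x" by (auto simp: prob_density_def)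
  obtain b k A where pdn: "\<And>n. 1 \<le> n \<Longrightarrow> prob_density (separated_sum b k n :: real^'d \<Rightarrow> real)"
    and lim: "(\<lambda>n. \<integral>\<^sup>+ x. ennreal \<bar>separated_sum b k n x - K x\<bar> \<partial>lborel) \<longlonglongrightarrow> 0"
    and bk: "\<And>n i. 1 \<le> n \<Longrightarrow> i \<in> {1..n} \<Longrightarrow> 0 \<le> b n i" 
      "\<And>n i. 1 \<le> n \<Longrightarrow> i \<in> {1..n} \<Longrightarrow> k n i \<in> borel_measurable borel"
      "\<And>n i t. 1 \<le> n \<Longrightarrow> i \<in> {1..n} \<Longrightarrow> 0 \<le> k n i t"
    and A: "A > 0" "\<And>n i. 1 \<le> n \<Longrightarrow> i \<in> {1..n} \<Longrightarrow> (\<integral>\<^sup>+ t. ennreal (k n i t) \<partial>lborel) = 1"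
      "\<And>n i. 1 \<le> n \<Longrightarrow> i \<in> {1..n} \<Longrightarrow> (\<integral>\<^sup>+ t. ennreal (\<bar>t\<bar> * k n i t) \<partial>lborel) \<le> ennreal A"
    using assms unfolding separated_assumption_def by blast
  have expand: "(\<integral>\<^sup>+x. ennreal (w x * separated_sum b k n x) \<partial>lborel)
     = (\<Sum>i=1..n. ennreal (b n i) * (\<integral>\<^sup>+x. ennreal (w x * (\<Prod>j\<in>UNIV. k n i (x $ j))) \<partial>lborel))"
    if n: "1 \<le> n" and w [measurable]: "w \<in> borel_measurable borel" "\<And>x. 0 \<le> w x" for n and w :: "real^'d \<Rightarrow> real"
  proof -
    have [measurable]: "i \<in> {1..n} \<Longrightarrow> k n i \<in> borel_measurable borel" for i by (rule bk(2)[OF n])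
    have "(\<integral>\<^sup>+x. ennreal (w x * separated_sum b k n x) \<partial>lborel)
       = (\<integral>\<^sup>+x. (\<Sum>i=1..n. ennreal (b n i) * ennreal (w x * (\<Prod>j\<in>UNIV. k n i (x $ j)))) \<partial>lborel)"
    proof (rule nn_integral_cong)
      fix x :: "real^'d"
      have "w x * separated_sum b k n x = (\<Sum>i=1..n. b n i * (w x * (\<Prod>j\<in>UNIV. k n i (x $ j))))"
        by (simp add: separated_sum_def sum_distrib_left ac_simps)
      also have "ennreal \<dots> = (\<Sum>i=1..n. ennreal (b n i * (w x * (\<Prod>j\<in>UNIV. k n i (x $ j)))))"
        using bk n w(2) by (intro sum_ennreal[symmetric] mult_nonneg_nonneg prod_nonneg) auto
      also have "\<dots> = (\<Sum>i=1..n. ennreal (b n i) * ennreal (w x * (\<Prod>j\<in>UNIV. k n i (x $ j))))"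
        using bk n w(2) by (intro sum.cong refl ennreal_mult mult_nonneg_nonneg prod_nonneg) auto
      finally show "ennreal (w x * separated_sum b k n x) = (\<Sum>i=1..n. ennreal (b n i) * ennreal (w x * (\<Prod>j\<in>UNIV. k n i (x $ j))))" .
    qed
    also have "\<dots> = (\<Sum>i=1..n. \<integral>\<^sup>+x. ennreal (b n i) * ennreal (w x * (\<Prod>j\<in>UNIV. k n i (x $ j))) \<partial>lborel)"
      by (rule nn_integral_sum) measurable
    also have "\<dots> = (\<Sum>i=1..n. ennreal (b n i) * (\<integral>\<^sup>+x. ennreal (w x * (\<Prod>j\<in>UNIV. k n i (x $ j))) \<partial>lborel))"
      by (intro sum.cong refl nn_integral_cmult) measurable
    finally show ?thesis .
  qed
  \<comment> \<open>The weights sum to 1 because the approximating densities and their product factors are normalized.\<close>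
  have sum_b: "(\<Sum>i=1..n. ennreal (b n i)) = 1" if n: "1 \<le> n" for n
  proof -
    have "(\<integral>\<^sup>+x. ennreal (\<Prod>j\<in>UNIV. k n i (x $ j)) \<partial>(lborel :: (real^'d) measure)) = 1" if i: "i \<in> {1..n}" for i
    proof -
      have [measurable]: "k n i \<in> borel_measurable borel" by (rule bk(2)[OF n i])
      show ?thesis
        using nn_integral_vec_prod[of "\<lambda>(_::'d) t. ennreal (k n i t)"] bk(3)[OF n i] A(2)[OF n i]
        by (simp add: prod_ennreal)
    qed
    then have "(\<Sum>i=1..n. ennreal (b n i)) = (\<integral>\<^sup>+x. ennreal (1 * separated_sum b k n x) \<partial>(lborel :: (real^'d) measure))"
      using expand[OF n, of "\<lambda>_. 1"] by simp
    also have "\<dots> = 1" using pdn[OF n] by (simp add: prob_density_def)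
    finally show ?thesis .
  qed
  have "(\<integral>\<^sup>+x. ennreal (\<bar>x $ j\<bar> * K x) \<partial>lborel) \<le> ennreal A" for j
  proof (rule truncated_moment_limit[OF _ _ _ nn _ _ lim])
    fix n :: nat assume n: "1 \<le> n"
    show "separated_sum b k n \<in> borel_measurable (borel :: (real^'d) measure)" "\<And>x::real^'d. 0 \<le> separated_sum b k n x"
      using pdn[OF n] by (auto simp: prob_density_def)
    have "(\<integral>\<^sup>+x. ennreal (\<bar>x $ j\<bar> * separated_sum b k n x) \<partial>lborel)
       = (\<Sum>i=1..n. ennreal (b n i) * (\<integral>\<^sup>+x. ennreal (\<bar>x $ j\<bar> * (\<Prod>j\<in>UNIV. k n i (x $ j))) \<partial>(lborel :: (real^'d) measure)))"
      by (rule expand[OF n]) auto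
    also have "\<dots> \<le> (\<Sum>i=1..n. ennreal (b n i) * ennreal A)"
    proof (intro sum_mono mult_left_mono)
      fix i assume i: "i \<in> {1..n}"
      have "(\<integral>\<^sup>+x. ennreal (\<bar>x $ j\<bar> * (\<Prod>j\<in>UNIV. k n i (x $ j))) \<partial>(lborel :: (real^'d) measure)) = (\<integral>\<^sup>+t. ennreal (\<bar>t\<bar> * k n i t) \<partial>lborel)"
        by (rule nn_integral_vec_prod_moment) (use bk(2,3)[OF n i] A(2)[OF n i] in auto)
      also have "\<dots> \<le> ennreal A" by (rule A(3)[OF n i])
      finally show "(\<integral>\<^sup>+x. ennreal (\<bar>x $ j\<bar> * (\<Prod>j\<in>UNIV. k n i (x $ j))) \<partial>(lborel :: (real^'d) measure)) \<le> ennreal A" .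
    qed simp
    also have "\<dots> = ennreal A" using sum_b[OF n] by (simp add: sum_distrib_right[symmetric])
    finally show "(\<integral>\<^sup>+x. ennreal (\<bar>x $ j\<bar> * separated_sum b k n x) \<partial>lborel) \<le> ennreal A" .
  qed (use nn in auto)
  then have fin: "(\<integral>\<^sup>+x. ennreal (\<bar>x $ j\<bar> * K x) \<partial>lborel) < \<infinity>" for j
    by (rule le_less_trans) simp
  show "(\<integral>\<^sup>+x. ennreal (norm x * K x) \<partial>lborel) < \<infinity>"
    by (rule finite_first_moment[OF _ nn fin]) measurable
qed

section \<open>Gaussian densities\<close>

lemma symmetric_matrix_dot:
  fixes S :: "real^'d::finite^'d"
  assumes "transpose S = S"
  shows "x \<bullet> (S *v y) = (S *v x) \<bullet> y"
  using dot_lmul_matrix[of x S y] assms by (metis transpose_matrix_vector)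

text \<open>Lagrange multipliers: if \<open>w\<close> is the part of \<open>S v\<close> orthogonal to \<open>v\<close>, then to first order in \<open>t\<close> the form at \<open>v + t w\<close>
exceeds its maximum by \<open>2 t \<bar>w\<bar>\<^sup>2\<close> while the norm stays 1, so \<open>w\<close> vanishes.\<close>

lemma quadratic_form_maximum_eigenvector:
  fixes S :: "real^'d::finite^'d"
  assumes sym: "transpose S = S" and V: "subspace V" "\<And>x. x \<in> V \<Longrightarrow> S *v x \<in> V"
    and v: "v \<in> V" "norm v = 1" and max: "\<And>x. x \<in> V \<Longrightarrow> norm x = 1 \<Longrightarrow> x \<bullet> (S *v x) \<le> v \<bullet> (S *v v)"
  shows "S *v v = (v \<bullet> (S *v v)) *\<^sub>R v"
proof -
  let ?\<mu> = "v \<bullet> (S *v v)"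
  let ?q = "\<lambda>x. x \<bullet> (S *v x)"
  have hom: "?q x \<le> ?\<mu> * (x \<bullet> x)" if "x \<in> V" for x
  proof (cases "x = 0")
    case False
    have "?q ((1 / norm x) *\<^sub>R x) \<le> ?\<mu>"
      using that False V(1) by (intro max) (auto intro: subspace_scale)
    then have "?q x / (norm x * norm x) \<le> ?\<mu>"
      by (simp add: matrix_vector_mult_scaleR)
    then show ?thesis using False
      by (simp add: divide_le_eq power2_norm_eq_inner[symmetric] power2_eq_square)
  qed simp
  define w where "w = S *v v - ?\<mu> *\<^sub>R v"
  have vv: "v \<bullet> v = 1" using v(2) by (simp add: norm_eq_1)
  have wV: "w \<in> V" unfolding w_def by (intro subspace_diff subspace_scale V v)
  have vw: "v \<bullet> w = 0" by (simp add: w_def inner_diff_right vv)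
  have wS: "w \<bullet> (S *v v) = w \<bullet> w"
  proof -
    have "w \<bullet> w = w \<bullet> (S *v v) - ?\<mu> * (w \<bullet> v)"
      by (subst (2) w_def) (simp add: inner_diff_right)
    then show ?thesis using vw by (simp add: inner_commute)
  qed
  have ineq: "2 * (w \<bullet> w) \<le> t * (?\<mu> * (w \<bullet> w) - ?q w)" if t: "0 < t" for t
  proof -
    have max: "?q (v + t *\<^sub>R w) \<le> ?\<mu> * ((v + t *\<^sub>R w) \<bullet> (v + t *\<^sub>R w))"
      by (intro hom subspace_add subspace_scale V v wV)
    have q: "?q (v + t *\<^sub>R w) = ?\<mu> + 2 * t * (w \<bullet> w) + t * t * ?q w"
      using symmetric_matrix_dot[OF sym, of v w] wS
      by (simp add: matrix_vector_right_distrib matrix_vector_mult_scaleR inner_add_left inner_add_right inner_commute algebra_simps)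
    have n: "(v + t *\<^sub>R w) \<bullet> (v + t *\<^sub>R w) = 1 + t * t * (w \<bullet> w)"
      using vw by (simp add: inner_add_left inner_add_right vv inner_commute)
    have "?\<mu> + 2 * t * (w \<bullet> w) + t * t * ?q w \<le> ?\<mu> * (1 + t * t * (w \<bullet> w))"
      using max unfolding q n .
    then have "t * (2 * (w \<bullet> w)) \<le> t * (t * (?\<mu> * (w \<bullet> w) - ?q w))"
      by (simp add: algebra_simps)
    then show ?thesis using t by simp
  qed
  have "w \<bullet> w \<le> 0"
  proof (rule ccontr)
    assume "\<not> w \<bullet> w \<le> 0"
    then have pos: "0 < w \<bullet> w" by (simp only: not_le)
    define B where "B = \<bar>?\<mu> * (w \<bullet> w) - ?q w\<bar>"
    \<comment> \<open>Small enough for the linear term to dominate the quadratic one.\<close>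
    define t where "t = (w \<bullet> w) / (B + 1)"
    have t: "0 < t" using pos by (simp add: t_def B_def)
    have "2 * (w \<bullet> w) \<le> t * (?\<mu> * (w \<bullet> w) - ?q w)" by (rule ineq[OF t])
    also have "\<dots> \<le> t * (B + 1)" using t by (intro mult_left_mono) (auto simp: B_def)
    also have "\<dots> = w \<bullet> w" by (simp add: t_def B_def)
    finally show False using pos by simp
  qed
  then have "w = 0" by (metis inner_eq_zero_iff inner_ge_zero order_antisym)
  then show ?thesis by (simp add: w_def)
qed

text \<open>The orthogonal complement of a set of eigenvectors is invariant under a symmetric matrix, so the next
eigenvector is found by maximizing the quadratic form on the unit sphere of the complement.\<close>

lemma orthonormal_eigenvectors:
  fixes S :: "real^'d::finite^'d"
  assumes sym: "transpose S = S" and "k \<le> CARD('d)"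
  shows "\<exists>B. finite B \<and> card B = k \<and> pairwise orthogonal B \<and> (\<forall>b\<in>B. norm b = 1 \<and> (\<exists>\<mu>. S *v b = \<mu> *\<^sub>R b))"
  using assms(2)
proof (induction k)
  case 0
  show ?case by (intro exI[of _ "{}"]) auto
next
  case (Suc k)
  then obtain B where B: "finite B" "card B = k" "pairwise orthogonal B"
    and eig: "\<And>b. b \<in> B \<Longrightarrow> norm b = 1 \<and> (\<exists>\<mu>. S *v b = \<mu> *\<^sub>R b)" by auto
  define V where "V = {x. \<forall>b\<in>B. b \<bullet> x = 0}"
  have sub: "subspace V" by (auto simp: V_def subspace_def inner_add_right)
  have inv: "S *v x \<in> V" if "x \<in> V" for x
    using that eig symmetric_matrix_dot[OF sym] by (fastforce simp: V_def)
  have dim: "dim B < DIM(real^'d)"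
    using dim_le_card'[OF B(1)] B(2) Suc.prems by simp
  then obtain x where x: "x \<noteq> 0" "\<And>y. y \<in> span B \<Longrightarrow> orthogonal x y"
    using orthogonal_to_subspace_exists[OF dim] by blast
  have "b \<bullet> x = 0" if "b \<in> B" for b
    using x(2)[OF span_base[OF that]] by (simp add: orthogonal_def inner_commute)
  then have xV: "x \<in> V" by (simp add: V_def)
  define C where "C = V \<inter> sphere 0 1"
  have closed: "closed V" by (rule closed_subspace[OF sub])
  have "compact C" unfolding C_def by (rule closed_Int_compact[OF closed compact_sphere])
  moreover have "C \<noteq> {}"
  proof -
    have "(1 / norm x) *\<^sub>R x \<in> C" using x(1) xV sub by (auto simp: C_def intro: subspace_scale)
    then show ?thesis by blast
  qed
  moreover have "continuous_on C (\<lambda>x. x \<bullet> (S *v x))" by (intro continuous_intros)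
  ultimately obtain v where v: "v \<in> C" "\<And>x. x \<in> C \<Longrightarrow> x \<bullet> (S *v x) \<le> v \<bullet> (S *v v)"
    using continuous_attains_sup[of C "\<lambda>x. x \<bullet> (S *v x)"] by blast
  have vp: "v \<in> V" "norm v = 1" using v(1) by (auto simp: C_def)
  have "S *v v = (v \<bullet> (S *v v)) *\<^sub>R v"
    by (rule quadratic_form_maximum_eigenvector[OF sym sub inv vp]) (use v(2) in \<open>auto simp: C_def\<close>)
  moreover have "v \<notin> B" using vp by (auto simp: V_def norm_eq_1)
  moreover have "pairwise orthogonal (insert v B)"
    using B(3) vp(1) by (auto simp: pairwise_insert orthogonal_def V_def inner_commute)
  ultimately show ?case
    using B eig vp by (intro exI[of _ "insert v B"]) auto
qed

lemma symmetric_matrix_diagonalization: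
  fixes S :: "real^'d::finite^'d"
  assumes sym: "transpose S = S"
  obtains P \<mu> where "orthogonal_matrix P" "S ** P = P ** (\<chi> i j. if i = j then \<mu> i else 0)"
proof -
  obtain B where B: "finite B" "card B = CARD('d)" "pairwise orthogonal B"
    and eig: "\<And>b. b \<in> B \<Longrightarrow> norm b = 1 \<and> (\<exists>\<mu>. S *v b = \<mu> *\<^sub>R b)"
    using orthonormal_eigenvectors[OF sym, of "CARD('d)"] by auto
  obtain h where h: "bij_betw h (UNIV::'d set) B"
    using finite_same_card_bij[of "UNIV::'d set" B] B by auto
  have hB: "h j \<in> B" for j using h by (auto simp: bij_betw_def)
  have "\<forall>j. \<exists>\<mu>. S *v h j = \<mu> *\<^sub>R h j" using eig[OF hB] by blast
  then obtain \<mu> where \<mu>: "\<And>j. S *v h j = \<mu> j *\<^sub>R h j" by metis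
  define P where "P = (\<chi> i j. h j $ i)"
  have ortho: "h i \<bullet> h j = (if i = j then 1 else 0)" for i j
  proof (cases "i = j")
    case True
    then show ?thesis using eig[OF hB] by (simp add: norm_eq_1)
  next
    case False
    then have "h i \<noteq> h j" using h by (auto simp: bij_betw_def inj_on_def)
    then show ?thesis using False B(3) hB by (auto simp: pairwise_def orthogonal_def)
  qed
  have "transpose P ** P = mat 1"
    using ortho by (simp add: matrix_matrix_mult_def transpose_def P_def mat_def vec_eq_iff inner_vec_def)
  then have P: "orthogonal_matrix P" by (simp add: orthogonal_matrix)
  have "(S ** P) $ i $ j = (P ** (\<chi> i j. if i = j then \<mu> i else 0)) $ i $ j" for i j
  proof -
    have "(S ** P) $ i $ j = (S *v h j) $ i"
      by (simp add: matrix_matrix_mult_def matrix_vector_mult_def P_def)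
    also have "\<dots> = \<mu> j * h j $ i" by (simp add: \<mu>)
    also have "\<dots> = (P ** (\<chi> i j. if i = j then \<mu> i else 0)) $ i $ j"
      by (simp add: matrix_matrix_mult_def P_def if_distrib[of "\<lambda>x. _ * x"] sum.delta cong: if_cong)
    finally show ?thesis .
  qed
  then have "S ** P = P ** (\<chi> i j. if i = j then \<mu> i else 0)" by (simp add: vec_eq_iff)
  then show ?thesis using that[OF P] by blast
qed

lemma sqrt_prod: "sqrt (\<Prod>j\<in>A. f j) = (\<Prod>j\<in>A. sqrt (f j))"
  by (induction A rule: infinite_finite_induct) (simp_all add: real_sqrt_mult)

text \<open>In an orthonormal basis of eigenvectors of the covariance matrix the coordinates are independent
centred Gaussians whose variances are the eigenvalues.\<close>

lemma gaussian_density_diagonalized: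
  fixes \<Sigma> :: "real^'d::finite^'d"
  assumes sym: "transpose \<Sigma> = \<Sigma>" and pos: "\<And>x. x \<noteq> 0 \<Longrightarrow> 0 < x \<bullet> (\<Sigma> *v x)"
  obtains P \<mu> where "orthogonal_matrix P" "\<And>j. 0 < \<mu> j"
    "\<And>u. gaussian_density \<Sigma> (P *v u) = (\<Prod>j\<in>UNIV. normal_density 0 (sqrt (\<mu> j)) (u $ j))"
proof -
  obtain P \<mu> where P: "orthogonal_matrix P" and dia: "\<Sigma> ** P = P ** (\<chi> i j. if i = j then \<mu> i else 0)"
    by (rule symmetric_matrix_diagonalization[OF sym])
  let ?D = "(\<chi> i j. if i = j then \<mu> i else 0) :: real^'d^'d"
  have PT: "transpose P ** P = mat 1" "P ** transpose P = mat 1" using P by (auto simp: orthogonal_matrix_def)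
  have inner_P: "(P *v x) \<bullet> (P *v y) = x \<bullet> y" for x y
    using P orthogonal_transformation_matrix[of "(*v) P"] by (simp add: orthogonal_transformation_def)
  have Dv: "?D *v u = (\<chi> j. \<mu> j * u $ j)" for u
    by (simp add: matrix_vector_mult_def vec_eq_iff if_distrib[of "\<lambda>x. x * _"] sum.delta cong: if_cong)
  have \<Sigma>P: "\<Sigma> *v (P *v u) = P *v (\<chi> j. \<mu> j * u $ j)" for u
    by (simp only: matrix_vector_mul_assoc dia) (simp only: matrix_vector_mul_assoc[symmetric] Dv)
  have \<mu>: "0 < \<mu> j" for j
  proof -
    have "norm (P *v axis j 1) = 1"
      using inner_P[of "axis j 1" "axis j 1"] by (simp add: norm_eq_1 inner_axis_axis)
    then have "P *v axis j 1 \<noteq> 0" by auto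
    from pos[OF this] have "0 < axis j 1 \<bullet> (\<chi> i. \<mu> i * axis j 1 $ i)" by (simp only: \<Sigma>P inner_P)
    then show ?thesis by (simp add: inner_axis')
  qed
  have inj: "inj ((*v) \<Sigma>)"
  proof (rule injI)
    fix x y assume "\<Sigma> *v x = \<Sigma> *v y"
    then have "\<Sigma> *v (x - y) = 0" by (simp add: matrix_vector_mult_diff_distrib)
    then show "x = y" using pos[of "x - y"] by auto
  qed
  then have "invertible \<Sigma>" using matrix_left_invertible_injective[of \<Sigma>] invertible_left_inverse by blast
  then have inv: "matrix_inv \<Sigma> ** \<Sigma> = mat 1"
    unfolding invertible_def matrix_inv_def by (rule someI2_ex) simp
  have inv_P: "matrix_inv \<Sigma> *v (P *v u) = P *v (\<chi> j. u $ j / \<mu> j)" for u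
  proof -
    have "\<Sigma> *v (P *v (\<chi> j. u $ j / \<mu> j)) = P *v u"
      using \<mu> by (simp add: \<Sigma>P less_imp_neq[symmetric])
    then show ?thesis by (metis inv matrix_vector_mul_assoc matrix_vector_mul_lid)
  qed
  have quad: "(P *v u) \<bullet> (matrix_inv \<Sigma> *v (P *v u)) = (\<Sum>j\<in>UNIV. (u $ j)\<^sup>2 / \<mu> j)" for u
    unfolding inv_P inner_P by (simp add: inner_vec_def power2_eq_square)
  have "det \<Sigma> * det P = det P * det ?D" using arg_cong[OF dia, of det] by (simp only: det_mul)
  moreover have "det P \<noteq> 0" using det_orthogonal_matrix[OF P] by auto
  ultimately have "det \<Sigma> = det ?D" by simp
  also have "\<dots> = (\<Prod>j\<in>UNIV. \<mu> j)" by (subst det_diagonal) simp_all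
  finally have det: "det \<Sigma> = (\<Prod>j\<in>UNIV. \<mu> j)" .
  have "gaussian_density \<Sigma> (P *v u) = (\<Prod>j\<in>UNIV. normal_density 0 (sqrt (\<mu> j)) (u $ j))" for u
  proof -
    have "sqrt ((2 * pi) ^ CARD('d) * det \<Sigma>) = sqrt (\<Prod>j\<in>UNIV. 2 * pi * \<mu> j)"
      by (simp add: det prod.distrib)
    also have "\<dots> = (\<Prod>j\<in>UNIV. sqrt (2 * pi * \<mu> j))" 
      by (rule sqrt_prod)
    finally have 1: "sqrt ((2 * pi) ^ CARD('d) * det \<Sigma>) = (\<Prod>j\<in>UNIV. sqrt (2 * pi * \<mu> j))" .
    have 2: "exp (- (\<Sum>j\<in>UNIV. (u $ j)\<^sup>2 / \<mu> j) / 2) = (\<Prod>j\<in>UNIV. exp (- (u $ j)\<^sup>2 / (2 * \<mu> j)))"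
      by (simp add: exp_sum[symmetric] sum_negf sum_divide_distrib mult.commute)
    show ?thesis
      unfolding gaussian_density_def quad 1 2 using \<mu>
      by (simp add: normal_density_def prod_dividef[symmetric] less_imp_le)
  qed
  with P \<mu> show ?thesis by (rule that)
qed

text \<open>Mass and first moment reduce to the one-dimensional normal distribution by rotating to the eigenbasis;
the lower bound on balls is continuity and positivity on a compact set.\<close>

lemma gaussian_regular_density:
  fixes \<Sigma> :: "real^'d::finite^'d"
  assumes sym: "transpose \<Sigma> = \<Sigma>" and pos: "\<And>x. x \<noteq> 0 \<Longrightarrow> 0 < x \<bullet> (\<Sigma> *v x)"
  shows "regular_density (gaussian_density \<Sigma>)"
proof -
  let ?K = "gaussian_density \<Sigma>"
  obtain P \<mu> where P: "orthogonal_matrix P" and \<mu>: "\<And>j. 0 < \<mu> j"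
    and KP: "\<And>u. ?K (P *v u) = (\<Prod>j\<in>UNIV. normal_density 0 (sqrt (\<mu> j)) (u $ j))"
    using gaussian_density_diagonalized[OF sym pos] by metis
  have T: "orthogonal_transformation ((*v) P)" using P by (simp add: orthogonal_transformation_matrix)
  have K_pos: "0 < ?K x" for x
  proof -
    obtain u where "x = P *v u" using orthogonal_transformation_surj[OF T] by (metis surjD)
    then show ?thesis using \<mu> by (simp add: KP prod_pos normal_density_pos)
  qed
  have cont: "continuous_on S ?K" for S
    unfolding gaussian_density_def[abs_def] divide_inverse by (intro continuous_intros)
  have [measurable]: "?K \<in> borel_measurable borel" by (rule borel_measurable_continuous_onI[OF cont])
  have one: "(\<integral>\<^sup>+t. ennreal (normal_density 0 (sqrt (\<mu> j)) t) \<partial>lborel) = 1" for j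
    using \<mu>[of j] by (simp add: nn_integral_eq_integral integrable_normal_density integral_normal_density)
  have mass: "(\<integral>\<^sup>+x. ennreal (?K x) \<partial>lborel) = 1"
  proof -
    have "(\<integral>\<^sup>+x. ennreal (?K x) \<partial>lborel) = (\<integral>\<^sup>+u. ennreal (?K (P *v u)) \<partial>lborel)"
      by (rule nn_integral_lborel_orthogonal[OF T, symmetric]) measurable
    also have "\<dots> = (\<integral>\<^sup>+u. (\<Prod>j\<in>UNIV. ennreal (normal_density 0 (sqrt (\<mu> j)) (u $ j))) \<partial>(lborel :: (real^'d) measure))"
      by (simp add: KP prod_ennreal)
    also have "\<dots> = 1" by (subst nn_integral_vec_prod) (simp_all add: one)
    finally show ?thesis .
  qed
  have moment: "(\<integral>\<^sup>+x. ennreal (norm x * ?K x) \<partial>lborel) < \<infinity>"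
  proof -
    have "(\<integral>\<^sup>+x. ennreal (norm x * ?K x) \<partial>lborel) = (\<integral>\<^sup>+u. ennreal (norm (P *v u) * ?K (P *v u)) \<partial>lborel)"
      by (rule nn_integral_lborel_orthogonal[OF T, symmetric]) measurable
    also have "\<dots> = (\<integral>\<^sup>+u. ennreal (norm u * (\<Prod>j\<in>UNIV. normal_density 0 (sqrt (\<mu> j)) (u $ j))) \<partial>(lborel :: (real^'d) measure))"
      by (simp add: KP orthogonal_transformation_norm[OF T])
    also have "\<dots> < \<infinity>"
    proof (rule finite_first_moment)
      fix l :: 'd
      have "integrable lborel (\<lambda>t. normal_density 0 (sqrt (\<mu> l)) t * \<bar>t - 0\<bar> ^ 1)"
        by (rule integrable_normal_moment_abs) (simp add: \<mu>)
      then have "(\<integral>\<^sup>+t. ennreal (\<bar>t\<bar> * normal_density 0 (sqrt (\<mu> l)) t) \<partial>lborel) < \<infinity>"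
        by (subst nn_integral_eq_integral) (simp_all add: mult.commute)
      then show "(\<integral>\<^sup>+u. ennreal (\<bar>u $ l\<bar> * (\<Prod>j\<in>UNIV. normal_density 0 (sqrt (\<mu> j)) (u $ j))) \<partial>(lborel :: (real^'d) measure)) < \<infinity>"
        by (subst nn_integral_vec_prod_moment) (simp_all add: one)
    qed (simp_all add: prod_nonneg)
    finally show ?thesis .
  qed
  have "\<exists>c>0. \<forall>x. norm x \<le> R \<longrightarrow> c \<le> ?K x" for R
  proof (cases "R < 0")
    case True
    then show ?thesis by (intro exI[of _ 1]) (auto dest: order_trans[OF norm_ge_zero])
  next
    case False
    then obtain y where "y \<in> cball (0::real^'d) R" "\<And>x. x \<in> cball 0 R \<Longrightarrow> ?K y \<le> ?K x"
      using continuous_attains_inf[OF compact_cball _ cont, of 0 R] by (auto simp: not_less)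
    then show ?thesis using K_pos[of y] by (intro exI[of _ "?K y"]) auto
  qed
  then show ?thesis
    unfolding regular_density_def prob_density_def using K_pos mass moment by (auto intro: less_imp_le)
qed

theorem theorem1p1:
  fixes M :: nat
    and E :: "nat \<Rightarrow> (real^'d) set"
    and D :: "nat \<Rightarrow> real^'d^'d"
    and e :: "nat \<Rightarrow> real^'d"
    and K :: "real^'d \<Rightarrow> real"
  assumes "bernoulli_data M E D e"
    and "gaussian_assumption M E D e K \<or> separated_assumption M E D e K"
  shows "\<exists>C::real. \<forall>\<^sub>F \<epsilon> in at_right 0.
    ereal_of_enat (t_mix (bernoulli_map M E D e) (noise_law K \<epsilon>)) \<le> ereal (C * \<bar>ln \<epsilon>\<bar>)"
proof (rule t_mix_regular_density[OF assms(1)])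
  show "regular_density K"
    using assms(2)
  proof
    assume "gaussian_assumption M E D e K"
    then show ?thesis unfolding gaussian_assumption_def using gaussian_regular_density by blast
  next
    assume "separated_assumption M E D e K"
    then show ?thesis by (rule separated_regular_density)
  qed
qed

end
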